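(* Let $n\geq 2$, $q\in(1,n]$, $p\in(0,q)$ and $\lambda>1$, and let $f$ be a smooth function on $S^{n-1}$. There exists a constant $C>0$ depending on $n,p,q,\lambda$ such that, for any $K\in\mathcal{K}^n_o$ with $d\tilde{C}_{p,q}(K,\cdot)=f\,d\mathcal{H}^{n-1}$, if $$\lambda^{-1}\mathcal{H}^{n-1}\leq\tilde{C}_{p,q}(K,\cdot)\leq\lambda\mathcal{H}^{n-1}$$ on $S^{n-1}$, then $$\max_{x\in S^{n-1}}h_K(x)\leq C\quad\text{and}\quad |K|\geq\frac1C .$$
   Context: A convex body in $\mathbb{R}^n$ is a compact convex set with nonempty interior; $\mathcal{K}^n_o$ is the class of convex bodies in $\mathbb{R}^n$ containing the origin in their interiors. $|K|$ is the volume ($n$-dimensional Lebesgue measure) of $K$, and $\mathcal{H}^{n-1}$ is the spherical Lebesgue measure on the unit sphere $S^{n-1}$. The support function of $K$ is $h_K(x)=\max\{x\cdot y:y\in K\}$ and the radial function is $\rho_K(x)=\max\{t: tx\in K\}$ for $x\neq 0$. For a Borel set $\eta\subset S^{n-1}$ let $\alpha_K^*(\eta)$ be the set of $u\in S^{n-1}$ such that $\partial K$ has an outer unit normal belonging to $\eta$ at the boundary point $\rho_K(u)u$. The $q$-th dual curvature measure is $\tilde{C}_q(K,\eta)=\int_{\alpha_K^*(\eta)}\rho_K^q(u)\,du$ and the $L_p$ dual curvature measure is defined by $d\tilde{C}_{p,q}(K,\cdot)=h_K^{-p}\,d\tilde{C}_q(K,\cdot)$. In this normalization, when $h=h_K$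 is $C^2$, the condition $d\tilde{C}_{p,q}(K,\cdot)=f\,d\mathcal{H}^{n-1}$ is the equation $$h^{1-p}(h^2+|\nabla h|^2)^{\frac{q-n}{2}}\det(\nabla^2h+hI)=f\quad\text{on }S^{n-1},$$ where $\nabla h$ and $\nabla^2h$ are the spherical gradient and Hessian with respect to a local orthonormal frame and $I$ is the identity matrix. *)

theory Defs
  imports "HOL-Analysis.Analysis"
begin

definition convex_body :: "'a::euclidean_space set \<Rightarrow> bool" where
  "convex_body K \<longleftrightarrow> compact K \<and> convex K \<and> interior K \<noteq> {}"

definition convex_bodies_o :: "'a::euclidean_space set set" where
  "convex_bodies_o = {K. convex_body K \<and> 0 \<in> interior K}"

definition support_fun :: "'a::euclidean_space set \<Rightarrow> 'a \<Rightarrow> real" where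
  "support_fun K x = (SUP y\<in>K. x \<bullet> y)"

definition radial_fun :: "'a::euclidean_space set \<Rightarrow> 'a \<Rightarrow> real" where
  "radial_fun K x = Sup {t. t *\<^sub>R x \<in> K}"

text \<open>Spherical Lebesgue measure: the measure of a Borel set \<open>\<eta>\<close> of the unit sphere is the
  dimension times the Lebesgue measure of the cone \<open>{t u | u \<in> \<eta>, 0 < t \<le> 1}\<close>.\<close>

definition spherical_measure :: "'a::euclidean_space measure" where
  "spherical_measure =
     scale_measure (of_nat DIM('a))
       (distr (restrict_space lborel (cball 0 1 - {0})) (restrict_space borel (sphere 0 1))
          (\<lambda>x. x /\<^sub>R norm x))"

definition outer_unit_normal :: "'a::euclidean_space set \<Rightarrow> 'a \<Rightarrow> 'a \<Rightarrow> bool" where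
  "outer_unit_normal K x v \<longleftrightarrow> x \<in> frontier K \<and> norm v = 1 \<and> (\<forall>y\<in>K. v \<bullet> (y - x) \<le> 0)"

definition reverse_radial_gauss_image :: "'a::euclidean_space set \<Rightarrow> 'a set \<Rightarrow> 'a set" where
  "reverse_radial_gauss_image K \<eta> =
     {u \<in> sphere 0 1. \<exists>v\<in>\<eta>. outer_unit_normal K (radial_fun K u *\<^sub>R u) v}"

text \<open>The reverse radial Gauss image of a Borel set is in general only measurable with respect to
  the completed spherical Lebesgue measure, so the integral is taken with respect to the
  completion. The set function is countably additive for bodies with the origin in the interior;
  no normalizing factor \<open>1/n\<close> is used.\<close>

definition dual_curvature :: "real \<Rightarrow> 'a::euclidean_space set \<Rightarrow> 'a measure" where
  "dual_curvature q K =
     measure_of (sphere 0 1) (sets (restrict_space borel (sphere 0 1)))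
       (\<lambda>\<eta>. \<integral>\<^sup>+u\<in>reverse_radial_gauss_image K \<eta>. ennreal (radial_fun K u powr q)
              \<partial>completion spherical_measure)"

definition Lp_dual_curvature :: "real \<Rightarrow> real \<Rightarrow> 'a::euclidean_space set \<Rightarrow> 'a measure" where
  "Lp_dual_curvature p q K =
     density (dual_curvature q K) (\<lambda>v. ennreal (support_fun K v powr (- p)))"

text \<open>\<open>C\<^sup>k\<close> functions on an open set: all directional derivatives are \<open>C\<^sup>k\<^sup>-\<^sup>1\<close>.\<close>

primrec Ck_on :: "nat \<Rightarrow> 'a::euclidean_space set \<Rightarrow> ('a \<Rightarrow> real) \<Rightarrow> bool" where
  "Ck_on 0 U F \<longleftrightarrow> continuous_on U F"
| "Ck_on (Suc k) U F \<longleftrightarrow>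
     (\<exists>F'. (\<forall>x\<in>U. (F has_derivative F' x) (at x)) \<and> (\<forall>v. Ck_on k U (\<lambda>x. F' x v)))"

text \<open>Smoothness on the sphere as an embedded submanifold: near each point the function agrees with
  the restriction of a smooth function on an open set of the ambient space. Values off the
  sphere are irrelevant.\<close>

definition smooth_on_sphere :: "('a::euclidean_space \<Rightarrow> real) \<Rightarrow> bool" where
  "smooth_on_sphere f \<longleftrightarrow>
     (\<forall>x\<in>sphere 0 1. \<exists>U F. open U \<and> x \<in> U \<and> (\<forall>k. Ck_on k U F) \<and>
        (\<forall>y\<in>U \<inter> sphere 0 1. f y = F y))"

end

theory Submission
  imports Defs
begin

text \<open>Let \<open>R\<close> be the largest norm of a point of \<open>K\<close>, let \<open>h\<close>, \<open>\<rho>\<close> be the support and radial functions, and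
  let \<open>\<mu>\<close> be the measure \<open>|x|\<^sup>q\<^sup>-\<^sup>n dx\<close>, for which \<open>\<mu>(K)\<close> is \<open>\<integral> \<rho>\<^sup>q du\<close> up to a constant factor. The total mass of
  the dual curvature measure is \<open>\<integral> \<rho>\<^sup>q du\<close>, and by the curvature bounds it is comparable with
  \<open>\<integral> h\<^sup>p\<close> over the sphere, which lies between multiples of \<open>R\<^sup>p\<close>: below, because \<open>h(v) \<ge> R (v \<bullet> e)\<close> for
  the direction \<open>e\<close> of a farthest point. So \<open>\<mu>(K)\<close> is of order \<open>R\<^sup>p\<close>.

  Always \<open>\<integral> \<rho>\<^sup>q du\<close> is at most a multiple of \<open>R\<^sup>q\<close>, so \<open>R\<^sup>q\<^sup>-\<^sup>p\<close> and hence \<open>R\<close> is bounded below. If all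
  widths of \<open>K\<close> are at least a fixed multiple of \<open>R\<close>, then the volume of \<open>K\<close> is at least a multiple of
  \<open>R\<^sup>n\<close> (\<open>volume_ge_of_widths\<close>), so \<open>\<mu>(K)\<close> is at least a multiple of \<open>R\<^sup>q\<close>; since \<open>p < q\<close>, this bounds \<open>R\<close>
  above, and both claims follow. Everything thus rests on excluding thin bodies (\<open>width_ge\<close>).

  The tool is the first variation of \<open>\<mu>\<close> (\<open>first_variation\<close>): a point of \<open>K + tQ\<close> in direction \<open>u\<close> has
  norm at most \<open>\<rho>(u) (1 + t h\<^sub>Q(v) / h(v))\<close> for any normal \<open>v\<close> at \<open>\<rho>(u) u\<close>. Integrating this pointwise
  inequality, the mass gained is \<open>O(t)\<close> times the integral of \<open>h\<^sub>Q / h\<close> against the dual curvature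
  measure, hence \<open>O(t) \<integral> h\<^sub>Q h\<^sup>p\<^sup>-\<^sup>1\<close> by the upper curvature bound (\<open>radial_weight_sum_le\<close>); no surface
  measure enters. It is used twice.

  With \<open>Q\<close> the part of \<open>K\<close> within distance \<open>\<delta> R\<close> of the origin it shows that, for small \<open>\<delta>\<close>, a fixed
  fraction of the mass lies outside this ball (\<open>radial_weight_le_far_part\<close>). With \<open>Q\<close> the unit ball it
  bounds a thin layer around \<open>K\<close>; if \<open>K\<close> has width \<open>W\<close> in some direction, translates of the layer in
  that direction cover the far part of \<open>K\<close>, whose mass is therefore at most a multiple of
  \<open>W \<integral> h\<^sup>p\<^sup>-\<^sup>1\<close>, the integral extending over the normals at contact points of norm at least a multiple of
  \<open>R\<close> (\<open>far_part_le\<close>). This integral is at most a multiple of \<open>R\<^sup>p\<^sup>-\<^sup>1\<close> (\<open>far_integral_le\<close>), whence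
  \<open>R\<^sup>p \<le> const \<cdot> W R\<^sup>p\<^sup>-\<^sup>1\<close>, that is, \<open>W \<ge> const \<cdot> R\<close>.

  The last bound is immediate for \<open>p \<ge> 1\<close>. For \<open>p < 1\<close> the integrand is large where the origin is close
  to a support hyperplane. But the contact point is a subgradient of \<open>h\<close>, so at the normals in
  question \<open>h\<close> has slope of order \<open>R\<close>, and being nonnegative it can be below \<open>s\<close> only on a set of measure
  of order \<open>s / R\<close> (\<open>steep_sublevel_measure\<close>).\<close>

section \<open>Polar coordinates\<close>

lemma nn_integral_lborel_affine:
  fixes f :: "'a::euclidean_space \<Rightarrow> ennreal"
  assumes "c \<noteq> 0" and [measurable]: "f \<in> borel_measurable borel"
  shows "(\<integral>\<^sup>+x. f x \<partial>lborel) = ennreal (\<bar>c\<bar> ^ DIM('a)) * (\<integral>\<^sup>+x. f (t + c *\<^sub>R x) \<partial>lborel)"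
proof -
  have "(\<integral>\<^sup>+x. f x \<partial>lborel)
      = (\<integral>\<^sup>+x. f x \<partial>density (distr lborel borel (\<lambda>x. t + c *\<^sub>R x)) (\<lambda>_. ennreal (\<bar>c\<bar>^DIM('a))))"
    by (subst lborel_affine[OF assms(1), of t]) (rule refl)
  also have "\<dots> = (\<integral>\<^sup>+x. ennreal (\<bar>c\<bar> ^ DIM('a)) * f (t + c *\<^sub>R x) \<partial>lborel)"
    by (simp add: nn_integral_density nn_integral_distr)
  also have "\<dots> = ennreal (\<bar>c\<bar> ^ DIM('a)) * (\<integral>\<^sup>+x. f (t + c *\<^sub>R x) \<partial>lborel)"
    by (rule nn_integral_cmult) measurable
  finally show ?thesis .
qed

lemma emeasure_lborel_affine_vimage:
  fixes t :: "'a::euclidean_space"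
  assumes "c \<noteq> 0" "A \<in> sets borel"
  shows "emeasure lborel A = ennreal (\<bar>c\<bar> ^ DIM('a)) * emeasure lborel {x. t + c *\<^sub>R x \<in> A}"
proof -
  have [measurable]: "A \<in> sets borel" by fact
  have "emeasure lborel A = (\<integral>\<^sup>+x. indicator A x \<partial>lborel)" by simp
  also have "\<dots> = ennreal (\<bar>c\<bar> ^ DIM('a)) * (\<integral>\<^sup>+x. indicator A (t + c *\<^sub>R x) \<partial>lborel)"
    by (rule nn_integral_lborel_affine[OF assms(1)]) measurable
  also have "(\<integral>\<^sup>+x. indicator A (t + c *\<^sub>R x) \<partial>lborel)
      = (\<integral>\<^sup>+x. indicator {x. t + c *\<^sub>R x \<in> A} x \<partial>(lborel :: 'a measure))"
    by (rule nn_integral_cong) (simp add: indicator_def)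
  also have "\<dots> = emeasure lborel {x. t + c *\<^sub>R x \<in> A}"
    by (rule nn_integral_indicator) measurable
  finally show ?thesis .
qed

abbreviation sphere_borel :: "'a::euclidean_space measure" where
  "sphere_borel \<equiv> restrict_space borel (sphere 0 1)"

lemma sets_sphere_borel: "\<eta> \<in> sets (sphere_borel :: 'a::euclidean_space measure) \<longleftrightarrow>
    \<eta> \<in> sets borel \<and> \<eta> \<subseteq> sphere 0 1"
  by (subst sets_restrict_space_iff) (auto simp: Int_absorb1)

lemma space_spherical_measure [simp]: "space spherical_measure = sphere 0 1"
  and sets_spherical_measure [simp, measurable_cong]: "sets spherical_measure = sets sphere_borel"
  by (simp_all add: spherical_measure_def space_scale_measure space_restrict_space)

lemma measurable_normalise [measurable]:
  "(\<lambda>x::'a::euclidean_space. x /\<^sub>R norm x) \<in> borel_measurable borel"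
  by measurable

lemma cone_borel:
  fixes \<eta> :: "'a::euclidean_space set"
  assumes "\<eta> \<in> sets sphere_borel" 
  shows "{x. x \<noteq> 0 \<and> x /\<^sub>R norm x \<in> \<eta>} \<in> sets borel"
proof -
  have [measurable]: "\<eta> \<in> sets borel" using assms by (simp add: sets_sphere_borel)
  show ?thesis by measurable
qed

lemma measurable_normalise_restrict:
  assumes "A \<in> sets (borel :: 'a::euclidean_space measure)" "0 \<notin> A"
  shows "(\<lambda>x::'a. x /\<^sub>R norm x) \<in> measurable (restrict_space lborel A) sphere_borel"
proof (rule measurable_restrict_space2)
  show "(\<lambda>x::'a. x /\<^sub>R norm x) \<in> space (restrict_space lborel A) \<rightarrow> sphere 0 1"
    using assms by (auto simp: space_restrict_space intro!: left_inverse)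
  show "(\<lambda>x::'a. x /\<^sub>R norm x) \<in> borel_measurable (restrict_space lborel A)"
    by (rule measurable_restrict_space1) simp
qed

lemma emeasure_spherical_measure:
  fixes \<eta> :: "'a::euclidean_space set"
  assumes "\<eta> \<in> sets sphere_borel"
  shows "emeasure spherical_measure \<eta>
    = of_nat DIM('a) * emeasure lborel {x. x \<noteq> 0 \<and> norm x \<le> 1 \<and> x /\<^sub>R norm x \<in> \<eta>}"
proof -
  let ?A = "cball (0::'a) 1 - {0}"
  have "emeasure spherical_measure \<eta> = of_nat DIM('a) *
      emeasure (restrict_space lborel ?A) ((\<lambda>x. x /\<^sub>R norm x) -` \<eta> \<inter> space (restrict_space lborel ?A))"
    unfolding spherical_measure_def
    by (simp add: emeasure_distr[OF measurable_normalise_restrict assms])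
  also have "(\<lambda>x. x /\<^sub>R norm x) -` \<eta> \<inter> space (restrict_space lborel ?A)
      = {x. x \<noteq> 0 \<and> norm x \<le> 1 \<and> x /\<^sub>R norm x \<in> \<eta>}"
    by (auto simp: space_restrict_space)
  also have "emeasure (restrict_space lborel ?A) \<dots> = emeasure lborel \<dots>"
    by (subst emeasure_restrict_space) auto
  finally show ?thesis .
qed

lemma emeasure_cone_ball:
  fixes \<eta> :: "'a::euclidean_space set"
  assumes \<eta>: "\<eta> \<in> sets sphere_borel" and a: "0 < a"
  shows "emeasure lborel {x. x \<noteq> 0 \<and> norm x \<le> a \<and> x /\<^sub>R norm x \<in> \<eta>}
    = ennreal (a ^ DIM('a) / DIM('a)) * emeasure spherical_measure \<eta>"
proof -
  have [measurable]: "\<eta> \<in> sets borel" using \<eta> by (simp add: sets_sphere_borel)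
  have "{x. x \<noteq> 0 \<and> norm x \<le> a \<and> x /\<^sub>R norm x \<in> \<eta>} \<in> sets borel" by measurable
  from emeasure_lborel_affine_vimage[of a, OF _ this, of 0] a
  have "emeasure lborel {x. x \<noteq> 0 \<and> norm x \<le> a \<and> x /\<^sub>R norm x \<in> \<eta>}
     = ennreal (a ^ DIM('a)) * emeasure lborel {x. x \<noteq> 0 \<and> norm x \<le> 1 \<and> x /\<^sub>R norm x \<in> \<eta>}"
    by (simp add: divide_simps)
  also have "\<dots> = ennreal (a ^ DIM('a) / DIM('a)) * emeasure spherical_measure \<eta>"
    unfolding emeasure_spherical_measure[OF \<eta>]
    using a by (simp add: mult.assoc[symmetric] ennreal_of_nat_eq_real_of_nat ennreal_mult[symmetric])
  finally show ?thesis .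
qed

lemma emeasure_spherical_measure_finite:
  "emeasure spherical_measure (\<eta> :: 'a::euclidean_space set) < \<infinity>"
proof (cases "\<eta> \<in> sets sphere_borel")
  case True
  have "emeasure lborel {x. x \<noteq> 0 \<and> norm x \<le> 1 \<and> x /\<^sub>R norm x \<in> \<eta>} \<le> emeasure lborel (cball (0::'a) 1)"
    by (rule emeasure_mono) auto
  also have "\<dots> < \<infinity>" by (rule emeasure_lborel_cball_finite)
  finally show ?thesis
    unfolding emeasure_spherical_measure[OF True] by (simp add: ennreal_mult_less_top of_nat_less_top)
qed (simp add: emeasure_notin_sets)

lemma finite_spherical_measure: "finite_measure (spherical_measure :: 'a::euclidean_space measure)"
  using emeasure_spherical_measure_finite[of "space spherical_measure"]
  by (intro finite_measureI) (simp add: less_top)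

definition radial_lebesgue :: "nat \<Rightarrow> real measure" where
  "radial_lebesgue n = density lborel (\<lambda>r. ennreal (r ^ (n - 1)) * indicator {0<..} r)"

lemma space_radial_lebesgue [simp]: "space (radial_lebesgue n) = UNIV"
  and sets_radial_lebesgue [simp, measurable_cong]: "sets (radial_lebesgue n) = sets borel"
  by (simp_all add: radial_lebesgue_def)

lemma emeasure_radial_lebesgue:
  assumes "0 < n" 
  shows "emeasure (radial_lebesgue n) {..a} = ennreal (if 0 < a then a ^ n / n else 0)"
proof -
  have "emeasure (radial_lebesgue n) {..a}
      = (\<integral>\<^sup>+r. ennreal (r ^ (n - 1)) * indicator {0<..} r * indicator {..a} r \<partial>lborel)"
    by (simp add: radial_lebesgue_def emeasure_density)
  also have "\<dots> = (\<integral>\<^sup>+r. ennreal (r ^ (n - 1)) * indicator {0..a} r \<partial>lborel)"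
  proof (rule nn_integral_cong_AE)
    show "AE r in lborel. ennreal (r ^ (n - 1)) * indicator {0<..} r * indicator {..a} r
        = ennreal (r ^ (n - 1)) * indicator {0..a} r"
      using AE_lborel_singleton[of "0::real"] by eventually_elim (auto simp: indicator_def)
  qed
  also have "\<dots> = ennreal (if 0 < a then a ^ n / n else 0)"
  proof (cases "0 < a")
    case True
    have "(\<integral>\<^sup>+r. ennreal (r ^ (n - 1)) * indicator {0..a} r \<partial>lborel) = ennreal (a ^ n / n - 0 ^ n / n)"
    proof (rule nn_integral_FTC_Icc)
      fix x :: real
      have "((\<lambda>x. x ^ n / n) has_real_derivative (real n * x ^ (n - 1)) / n) (at x)"
        by (auto intro!: derivative_eq_intros)
      then show "((\<lambda>x. x ^ n / n) has_real_derivative x ^ (n - 1)) (at x)" using assms by simp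
    qed (use True in auto)
    then show ?thesis using True assms by (simp add: zero_power)
  next
    case False
    have "AE r in lborel. ennreal (r ^ (n - 1)) * indicator {0..a} r = 0"
      using AE_lborel_singleton[of "0::real"]
      by eventually_elim (use False in \<open>auto simp: indicator_def\<close>)
    then have "(\<integral>\<^sup>+r. ennreal (r ^ (n - 1)) * indicator {0..a} r \<partial>lborel)
        = (\<integral>\<^sup>+r. 0 \<partial>(lborel :: real measure))"
      by (rule nn_integral_cong_AE)
    then show ?thesis using False by simp
  qed
  finally show ?thesis .
qed

lemma sigma_finite_radial_lebesgue:
  assumes "0 < n"
  shows "sigma_finite_measure (radial_lebesgue n)"
proof (rule sigma_finite_measure.intro, intro exI conjI)
  let ?A = "range (\<lambda>i::nat. {..real i})"
  show "countable ?A" by simp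
  show "?A \<subseteq> sets (radial_lebesgue n)" by auto
  show "\<Union> ?A = space (radial_lebesgue n)" using real_arch_simple by auto
  show "\<forall>a\<in>?A. emeasure (radial_lebesgue n) a \<noteq> \<infinity>"
    using emeasure_radial_lebesgue[OF assms] by simp
qed

text \<open>Both sides are measures in the set of radii, so it suffices to compare them on the
  half-lines, where the statement is the homogeneity of Lebesgue measure.\<close>

lemma emeasure_polar_rectangle:
  fixes \<eta> :: "'a::euclidean_space set"
  assumes \<eta>: "\<eta> \<in> sets sphere_borel" and B: "B \<in> sets borel"
  shows "emeasure lborel {x. x \<noteq> 0 \<and> norm x \<in> B \<and> x /\<^sub>R norm x \<in> \<eta>}
    = emeasure spherical_measure \<eta> * emeasure (radial_lebesgue DIM('a)) B"
proof -
  define C where "C = {x. x \<noteq> 0 \<and> x /\<^sub>R norm x \<in> \<eta>}"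
  have C: "C \<in> sets borel" unfolding C_def by (rule cone_borel[OF \<eta>])
  have mn: "norm \<in> measurable (restrict_space lborel C) borel"
    by (rule measurable_restrict_space1) simp
  have D: "emeasure (distr (restrict_space lborel C) borel norm) X
      = emeasure lborel {x. x \<noteq> 0 \<and> norm x \<in> X \<and> x /\<^sub>R norm x \<in> \<eta>}" if "X \<in> sets borel" for X
  proof -
    have "emeasure (distr (restrict_space lborel C) borel norm) X
        = emeasure (restrict_space lborel C) (norm -` X \<inter> space (restrict_space lborel C))"
      by (rule emeasure_distr[OF mn that])
    also have "norm -` X \<inter> space (restrict_space lborel C) = {x. x \<noteq> 0 \<and> norm x \<in> X \<and> x /\<^sub>R norm x \<in> \<eta>}"
      by (auto simp: space_restrict_space C_def)
    also have "emeasure (restrict_space lborel C) \<dots> = emeasure lborel \<dots>"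
      using C by (subst emeasure_restrict_space) (auto simp: C_def)
    finally show ?thesis .
  qed
  have key: "emeasure (distr (restrict_space lborel C) borel norm) {..a}
      = emeasure (scale_measure (emeasure spherical_measure \<eta>) (radial_lebesgue DIM('a))) {..a}" for a
  proof (cases "0 < a")
    case True
    then show ?thesis
      using emeasure_cone_ball[OF \<eta> True]
      by (simp add: D emeasure_radial_lebesgue mult.commute)
  next
    case False
    then have "{x. x \<noteq> 0 \<and> norm x \<in> {..a} \<and> x /\<^sub>R norm x \<in> \<eta>} = {}"
      using norm_le_zero_iff order_trans by (fastforce simp: not_less)
    then have "emeasure lborel {x. x \<noteq> 0 \<and> norm x \<in> {..a} \<and> x /\<^sub>R norm x \<in> \<eta>} = 0"
      by (simp only: emeasure_empty)
    then show ?thesis using False D[of "{..a}"] by (simp add: emeasure_radial_lebesgue del: atMost_iff)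
  qed
  have "distr (restrict_space lborel C) borel norm
      = scale_measure (emeasure spherical_measure \<eta>) (radial_lebesgue DIM('a))"
  proof (rule measure_eqI_generator_eq[where E="range atMost" and \<Omega>=UNIV and A="\<lambda>i::nat. {..real i}"])
    show "Int_stable (range atMost :: real set set)"
      by (auto simp: Int_stable_def)
    show "emeasure (distr (restrict_space lborel C) borel norm) {..real i} \<noteq> \<infinity>" for i :: nat
      unfolding key using emeasure_spherical_measure_finite[of \<eta>]
      by (auto simp: emeasure_radial_lebesgue ennreal_mult_eq_top_iff)
  qed (use key in \<open>auto simp: borel_eq_atMost real_arch_simple\<close>)
  then show ?thesis using D[OF B] by simp
qed

lemma polar_coordinates:
  fixes f :: "'a::euclidean_space \<Rightarrow> ennreal"
  assumes [measurable]: "f \<in> borel_measurable borel"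
  shows "(\<integral>\<^sup>+x. f x \<partial>lborel)
    = (\<integral>\<^sup>+u. (\<integral>\<^sup>+r. f (r *\<^sub>R u) \<partial>radial_lebesgue DIM('a)) \<partial>spherical_measure)"
proof -
  let ?P = "\<lambda>x::'a. (x /\<^sub>R norm x, norm x)"
  let ?L = "restrict_space lborel (- {0::'a})"
  let ?T = "radial_lebesgue DIM('a)"
  interpret S: finite_measure "spherical_measure :: 'a measure" by (rule finite_spherical_measure)
  interpret T: sigma_finite_measure ?T by (rule sigma_finite_radial_lebesgue) simp
  have P: "?P \<in> measurable ?L (spherical_measure \<Otimes>\<^sub>M ?T)"
  proof (rule measurable_Pair)
    show "(\<lambda>x. x /\<^sub>R norm x) \<in> measurable ?L spherical_measure"
      using measurable_normalise_restrict[of "-{0::'a}"] by (simp cong: measurable_cong_sets)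
    show "norm \<in> measurable ?L ?T"
      by (rule measurable_restrict_space1) (simp cong: measurable_cong_sets)
  qed
  have "spherical_measure \<Otimes>\<^sub>M ?T = distr ?L (spherical_measure \<Otimes>\<^sub>M ?T) ?P"
  proof (rule pair_measure_eqI)
    fix \<eta> :: "'a set" and B assume "\<eta> \<in> sets spherical_measure" "B \<in> sets ?T"
    then have \<eta>: "\<eta> \<in> sets sphere_borel" and B: "B \<in> sets borel" by auto
    have "emeasure (distr ?L (spherical_measure \<Otimes>\<^sub>M ?T) ?P) (\<eta> \<times> B)
        = emeasure ?L (?P -` (\<eta> \<times> B) \<inter> space ?L)"
      using \<eta> B by (intro emeasure_distr[OF P]) auto
    also have "?P -` (\<eta> \<times> B) \<inter> space ?L = {x. x \<noteq> 0 \<and> norm x \<in> B \<and> x /\<^sub>R norm x \<in> \<eta>}"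
      by (auto simp: space_restrict_space)
    also have "emeasure ?L \<dots> = emeasure lborel \<dots>"
      by (subst emeasure_restrict_space) auto
    finally show "emeasure spherical_measure \<eta> * emeasure ?T B
        = emeasure (distr ?L (spherical_measure \<Otimes>\<^sub>M ?T) ?P) (\<eta> \<times> B)"
      by (simp add: emeasure_polar_rectangle[OF \<eta> B])
  qed (auto intro: S.sigma_finite_measure_axioms T.sigma_finite_measure_axioms)
  note dist = this
  have id: "(\<lambda>x::'a. x) \<in> measurable spherical_measure borel"
    by (subst measurable_cong_sets[OF sets_spherical_measure refl]) (rule measurable_restrict_space1, simp)
  have m1: "(\<lambda>z::'a\<times>real. snd z *\<^sub>R fst z) \<in> borel_measurable (spherical_measure \<Otimes>\<^sub>M ?T)"
  proof (rule borel_measurable_scaleR)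
    show "(snd :: 'a \<times> real \<Rightarrow> real) \<in> borel_measurable (spherical_measure \<Otimes>\<^sub>M ?T)"
      by (rule measurable_compose[OF measurable_snd]) (simp cong: measurable_cong_sets)
    show "(fst :: 'a \<times> real \<Rightarrow> 'a) \<in> borel_measurable (spherical_measure \<Otimes>\<^sub>M ?T)"
      by (rule measurable_compose[OF measurable_fst id])
  qed
  have m2: "(\<lambda>z::'a\<times>real. f (snd z *\<^sub>R fst z)) \<in> borel_measurable (spherical_measure \<Otimes>\<^sub>M ?T)"
    by (rule measurable_compose[OF m1 assms])
  have "(\<integral>\<^sup>+u. (\<integral>\<^sup>+r. f (r *\<^sub>R u) \<partial>?T) \<partial>spherical_measure)
      = (\<integral>\<^sup>+z. f (snd z *\<^sub>R fst z) \<partial>(spherical_measure \<Otimes>\<^sub>M ?T))"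
    using T.nn_integral_fst[OF m2] by simp
  also have "\<dots> = (\<integral>\<^sup>+z. f (snd z *\<^sub>R fst z) \<partial>distr ?L (spherical_measure \<Otimes>\<^sub>M ?T) ?P)"
    using dist by simp
  also have "\<dots> = (\<integral>\<^sup>+x. f (norm x *\<^sub>R (x /\<^sub>R norm x)) \<partial>?L)"
    by (subst nn_integral_distr[OF P]) (use m2 in auto)
  also have "\<dots> = (\<integral>\<^sup>+x. f x \<partial>?L)"
    by (intro nn_integral_cong) (auto simp: space_restrict_space)
  also have "\<dots> = (\<integral>\<^sup>+x. f x * indicator (-{0}) x \<partial>lborel)"
    by (subst nn_integral_restrict_space) auto
  also have "\<dots> = (\<integral>\<^sup>+x. f x \<partial>lborel)"
  proof (rule nn_integral_cong_AE)
    show "AE x in lborel. f x * indicator (- {0}) x = f x"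
      using AE_lborel_singleton[of "0::'a"] by eventually_elim simp
  qed
  finally show ?thesis ..
qed

section \<open>Support and radial functions\<close>

lemma support_fun_ge:
  assumes "bounded Q" "y \<in> Q" shows "x \<bullet> y \<le> support_fun Q x"
proof -
  obtain B where B: "\<And>y. y \<in> Q \<Longrightarrow> norm y \<le> B" using assms(1) by (auto simp: bounded_iff)
  have "bdd_above ((\<bullet>) x ` Q)"
  proof (rule bdd_aboveI2)
    fix y assume "y \<in> Q"
    have "x \<bullet> y \<le> norm x * norm y" by (rule norm_cauchy_schwarz)
    also have "\<dots> \<le> norm x * B" using B[OF \<open>y \<in> Q\<close>] by (simp add: mult_left_mono)
    finally show "x \<bullet> y \<le> norm x * B" .
  qed
  then show ?thesis unfolding support_fun_def by (rule cSUP_upper[OF assms(2)])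
qed

lemma support_fun_le:
  assumes "Q \<noteq> {}" "\<And>y. y \<in> Q \<Longrightarrow> x \<bullet> y \<le> b" shows "support_fun Q x \<le> b"
  unfolding support_fun_def using assms by (rule cSUP_least)

lemma support_fun_attained:
  assumes "compact Q" "Q \<noteq> {}" obtains y where "y \<in> Q" "support_fun Q x = x \<bullet> y"
proof -
  obtain y where y: "y \<in> Q" "\<And>z. z \<in> Q \<Longrightarrow> x \<bullet> z \<le> x \<bullet> y"
    using continuous_attains_sup[OF assms continuous_on_inner[OF continuous_on_const continuous_on_id],
        of x] by auto
  have "support_fun Q x = x \<bullet> y"
    by (intro antisym support_fun_le support_fun_ge assms y compact_imp_bounded)
  with y that show ?thesis by blast
qed

lemma support_fun_norm_le:
  assumes "compact Q" "Q \<noteq> {}" "\<And>y. y \<in> Q \<Longrightarrow> norm y \<le> B"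
  shows "support_fun Q x \<le> B * norm x"
proof (rule support_fun_le[OF assms(2)])
  fix y assume "y \<in> Q"
  have "x \<bullet> y \<le> norm x * norm y" by (rule norm_cauchy_schwarz)
  also have "\<dots> \<le> norm x * B" using assms(3)[OF \<open>y \<in> Q\<close>] by (simp add: mult_left_mono)
  finally show "x \<bullet> y \<le> B * norm x" by (simp add: mult.commute)
qed

lemma support_fun_nonneg:
  assumes "bounded Q" "0 \<in> Q" shows "0 \<le> support_fun Q x"
  using support_fun_ge[OF assms, of x] by simp

lemma support_fun_mono:
  assumes "bounded P" "Q \<subseteq> P" "Q \<noteq> {}" shows "support_fun Q x \<le> support_fun P x"
  using assms by (intro support_fun_le support_fun_ge) auto

lemma continuous_on_support_fun:
  fixes Q :: "'a::euclidean_space set"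
  assumes "compact Q" "Q \<noteq> {}" shows "continuous_on X (support_fun Q)"
proof -
  obtain B where B: "B > 0" "\<And>y. y \<in> Q \<Longrightarrow> norm y \<le> B"
    using compact_imp_bounded[OF assms(1)] by (auto simp: bounded_pos)
  have *: "support_fun Q x - support_fun Q y \<le> B * dist x y" for x y :: 'a
  proof -
    obtain z where z: "z \<in> Q" "support_fun Q x = x \<bullet> z" by (rule support_fun_attained[OF assms])
    have "support_fun Q x - support_fun Q y \<le> (x - y) \<bullet> z"
      using support_fun_ge[OF compact_imp_bounded[OF assms(1)] z(1), of y] z(2)
      by (simp add: inner_diff_left)
    also have "\<dots> \<le> norm (x - y) * norm z" by (rule norm_cauchy_schwarz)
    also have "\<dots> \<le> norm (x - y) * B" using B(2)[OF z(1)] by (simp add: mult_left_mono)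
    finally show ?thesis by (simp add: dist_norm mult.commute)
  qed
  have "B-lipschitz_on X (support_fun Q)"
  proof (rule lipschitz_onI)
    fix x y show "dist (support_fun Q x) (support_fun Q y) \<le> B * dist x y"
      using *[of x y] *[of y x] by (simp add: dist_real_def abs_le_iff dist_commute)
  qed (use B in auto)
  then show ?thesis by (rule lipschitz_on_continuous_on)
qed

locale body_around_origin =
  fixes K :: "'a::euclidean_space set"
  assumes K: "K \<in> convex_bodies_o"
begin

lemma compact_K: "compact K" and convex_K: "convex K" and zero_interior: "0 \<in> interior K"
  using K by (auto simp: convex_bodies_o_def convex_body_def)

lemma closed_K: "closed K" and bounded_K: "bounded K" and zero_mem: "0 \<in> K" and nonempty: "K \<noteq> {}"
  using compact_K zero_interior interior_subset
  by (auto intro: compact_imp_closed compact_imp_bounded)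

lemma inball: obtains r where "0 < r" "cball 0 r \<subseteq> K"
  using zero_interior by (auto simp: mem_interior_cball)

lemma scale_mem: "x \<in> K \<Longrightarrow> 0 \<le> t \<Longrightarrow> t \<le> 1 \<Longrightarrow> t *\<^sub>R x \<in> K"
  using convexD_alt[OF convex_K zero_mem, of x t] by simp

lemma support_pos: assumes "x \<noteq> 0" shows "0 < support_fun K x"
proof -
  obtain r where r: "0 < r" "cball 0 r \<subseteq> K" by (rule inball)
  have "(r / norm x) *\<^sub>R x \<in> K" using r assms by (intro subsetD[OF r(2)]) simp
  from support_fun_ge[OF bounded_K this, of x] have "r * norm x \<le> support_fun K x"
    using assms by (simp add: power2_norm_eq_inner[symmetric] power2_eq_square)
  moreover have "0 < r * norm x" using r assms by simp
  ultimately show ?thesis by linarith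
qed

lemma radial_set:
  assumes "x \<noteq> 0"
  shows "radial_fun K x *\<^sub>R x \<in> K" "\<And>t. t *\<^sub>R x \<in> K \<Longrightarrow> t \<le> radial_fun K x"
proof -
  obtain B where B: "\<And>y. y \<in> K \<Longrightarrow> norm y \<le> B" using bounded_K by (auto simp: bounded_iff)
  let ?T = "{t. t *\<^sub>R x \<in> K}"
  have cl: "closed ?T"
    using continuous_closed_vimage[OF closed_K, of "\<lambda>t. t *\<^sub>R x"] by (auto simp: vimage_def)
  have bd: "bdd_above ?T"
  proof (rule bdd_aboveI)
    fix t assume "t \<in> ?T"
    then have "\<bar>t\<bar> * norm x \<le> B" using B by fastforce
    then show "t \<le> B / norm x" using assms by (simp add: field_simps) (smt (verit) mult_right_mono norm_ge_zero mult.commute)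
  qed
  have "0 \<in> ?T" using zero_mem by simp
  then have "Sup ?T \<in> ?T" by (intro closed_contains_Sup bd cl) blast+
  then show "radial_fun K x *\<^sub>R x \<in> K" by (simp add: radial_fun_def)
  show "t \<le> radial_fun K x" if "t *\<^sub>R x \<in> K" for t
    unfolding radial_fun_def using that bd by (intro cSup_upper) auto
qed

lemma radial_pos: assumes "x \<noteq> 0" shows "0 < radial_fun K x"
proof -
  obtain r where r: "0 < r" "cball 0 r \<subseteq> K" by (rule inball)
  have "(r / norm x) *\<^sub>R x \<in> K" using r assms by (intro subsetD[OF r(2)]) simp
  then have "r / norm x \<le> radial_fun K x" by (rule radial_set(2)[OF assms])
  moreover have "0 < r / norm x" using r assms by simp
  ultimately show ?thesis by linarith
qed

lemma mem_iff_le_radial: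
  assumes "x \<noteq> 0" "0 \<le> t" shows "t *\<^sub>R x \<in> K \<longleftrightarrow> t \<le> radial_fun K x"
proof
  assume "t \<le> radial_fun K x"
  then have "(t / radial_fun K x) *\<^sub>R (radial_fun K x *\<^sub>R x) \<in> K"
    using radial_pos[OF assms(1)] assms by (intro scale_mem radial_set) auto
  then show "t *\<^sub>R x \<in> K" using radial_pos[OF assms(1)] by simp
qed (rule radial_set(2)[OF assms(1)])

lemma radial_le:
  assumes "u \<in> sphere 0 1" "\<And>x. x \<in> K \<Longrightarrow> norm x \<le> R" shows "radial_fun K u \<le> R"
proof -
  have u: "u \<noteq> 0" "norm u = 1" using assms(1) by auto
  show ?thesis using assms(2)[OF radial_set(1)[OF u(1)]] radial_pos[OF u(1)] u by simp
qed

lemma radial_frontier: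
  assumes "x \<noteq> 0" shows "radial_fun K x *\<^sub>R x \<in> frontier K"
proof -
  have "radial_fun K x *\<^sub>R x \<notin> interior K"
  proof
    assume "radial_fun K x *\<^sub>R x \<in> interior K"
    then obtain e where e: "e > 0" "cball (radial_fun K x *\<^sub>R x) e \<subseteq> K" by (auto simp: mem_interior_cball)
    have "(radial_fun K x + e / norm x) *\<^sub>R x \<in> K"
      using e assms by (intro subsetD[OF e(2)]) (simp add: dist_norm scaleR_add_left)
    then have "radial_fun K x + e / norm x \<le> radial_fun K x" by (rule radial_set(2)[OF assms])
    moreover have "0 < e / norm x" using e assms by simp
    ultimately show False by linarith
  qed
  then show ?thesis using radial_set(1)[OF assms] closure_subset by (auto simp: frontier_def)
qed

lemma outer_unit_normal_iff:
  assumes "u \<in> sphere 0 1" "v \<in> sphere 0 1"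
  shows "outer_unit_normal K (radial_fun K u *\<^sub>R u) v
    \<longleftrightarrow> v \<bullet> (radial_fun K u *\<^sub>R u) = support_fun K v"
proof -
  have u: "u \<noteq> 0" and v: "norm v = 1" using assms by auto
  let ?x = "radial_fun K u *\<^sub>R u"
  have x: "?x \<in> K" by (rule radial_set(1)[OF u])
  show ?thesis
  proof
    assume "outer_unit_normal K ?x v"
    then have "support_fun K v \<le> v \<bullet> ?x"
      by (intro support_fun_le nonempty) (auto simp: outer_unit_normal_def inner_diff_right)
    then show "v \<bullet> ?x = support_fun K v" using support_fun_ge[OF bounded_K x, of v] by linarith
  next
    assume "v \<bullet> ?x = support_fun K v"
    then show "outer_unit_normal K ?x v"
      using support_fun_ge[OF bounded_K, of _ v] radial_frontier[OF u] v
      by (auto simp: outer_unit_normal_def inner_diff_right)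
  qed
qed

lemma ex_normal:
  assumes "u \<in> sphere 0 1"
  obtains v where "v \<in> sphere 0 1" "outer_unit_normal K (radial_fun K u *\<^sub>R u) v"
proof -
  have u: "u \<noteq> 0" using assms by auto
  let ?x = "radial_fun K u *\<^sub>R u"
  have x: "?x \<in> closure K" "?x \<notin> interior K" using radial_frontier[OF u] by (auto simp: frontier_def)
  have "rel_interior K = interior K" using zero_interior by (intro rel_interior_interior affine_hull_nonempty_interior) auto
  then obtain a where a: "a \<noteq> 0" "\<And>y. y \<in> closure K \<Longrightarrow> a \<bullet> ?x \<le> a \<bullet> y"
    using supporting_hyperplane_relative_frontier[OF convex_K x(1)] x(2) by metis
  have "outer_unit_normal K ?x (- (a /\<^sub>R norm a))"
    unfolding outer_unit_normal_def
  proof (intro conjI ballI)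
    fix y assume "y \<in> K"
    then have "a \<bullet> ?x \<le> a \<bullet> y" using closure_subset by (intro a(2)) auto
    then have "0 \<le> (a \<bullet> (y - ?x)) / norm a" by (simp add: inner_diff_right)
    then show "- (a /\<^sub>R norm a) \<bullet> (y - ?x) \<le> 0" by (simp add: divide_inverse mult.commute)
  qed (use radial_frontier[OF u] a in auto)
  then show ?thesis using a by (intro that[of "- (a /\<^sub>R norm a)"]) auto
qed

text \<open>Seen from the origin, the boundary points with a normal in \<open>\<eta>\<close> are the points of \<open>K\<close>
  at which some support hyperplane with normal in \<open>\<eta>\<close> is touched; for closed \<open>\<eta>\<close> these form a
  compact set.\<close>

lemma compact_reverse_radial_gauss_image:
  assumes "closed \<eta>" "\<eta> \<subseteq> sphere 0 1"
  shows "compact (reverse_radial_gauss_image K \<eta>)"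
proof -
  define Z where "Z = {z \<in> K \<times> \<eta>. snd z \<bullet> fst z = support_fun K (snd z)}"
  have "compact \<eta>" using assms compact_sphere by (metis compact_Int_closed inf.absorb_iff2)
  then have "compact (K \<times> \<eta>)" by (intro compact_Times compact_K)
  moreover have "closed {z. snd z \<bullet> fst z = support_fun K (snd z)}"
    by (intro closed_Collect_eq continuous_intros
        continuous_on_compose2[OF continuous_on_support_fun[OF compact_K nonempty, of UNIV]]) auto
  ultimately have "compact Z" unfolding Z_def by (simp add: Collect_conj_eq Int_def[symmetric] compact_Int_closed)
  moreover have nz: "fst z \<noteq> 0" if "z \<in> Z" for z
  proof
    assume "fst z = 0"
    then have "support_fun K (snd z) = 0" "snd z \<in> sphere 0 1" using that assms by (auto simp: Z_def)
    then show False using support_pos[of "snd z"] by (cases "snd z = 0") auto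
  qed
  ultimately have "compact ((\<lambda>z. fst z /\<^sub>R norm (fst z)) ` Z)"
    by (intro compact_continuous_image continuous_intros) auto
  moreover have "(\<lambda>z. fst z /\<^sub>R norm (fst z)) ` Z = reverse_radial_gauss_image K \<eta>"
  proof (intro equalityI subsetI)
    fix u assume "u \<in> (\<lambda>z. fst z /\<^sub>R norm (fst z)) ` Z"
    then obtain x v where z: "(x, v) \<in> Z" and u: "u = x /\<^sub>R norm x" by auto
    then have x: "x \<in> K" "v \<in> \<eta>" "v \<bullet> x = support_fun K v" "x \<noteq> 0" using nz[OF z] by (auto simp: Z_def)
    have us: "u \<in> sphere 0 1" "u \<noteq> 0" using x by (auto simp: u)
    have xu: "x = norm x *\<^sub>R u" using x by (simp add: u)
    have le: "norm x \<le> radial_fun K u" using x(1) xu us by (metis radial_set(2))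
    have vs: "v \<in> sphere 0 1" using x assms by auto
    have "0 < support_fun K v" using vs by (intro support_pos) auto
    then have "0 < norm x * (v \<bullet> u)" using x(3) xu by (metis inner_scaleR_right)
    then have "0 < v \<bullet> u" by (simp add: zero_less_mult_iff)
    have "support_fun K v \<le> v \<bullet> (radial_fun K u *\<^sub>R u)"
      using mult_right_mono[OF le, of "v \<bullet> u"] \<open>0 < v \<bullet> u\<close> x(3) xu by (metis inner_scaleR_right less_imp_le)
    then have "v \<bullet> (radial_fun K u *\<^sub>R u) = support_fun K v"
      using support_fun_ge[OF bounded_K radial_set(1)[OF us(2)], of v] by linarith
    then show "u \<in> reverse_radial_gauss_image K \<eta>"
      using x us outer_unit_normal_iff[OF us(1) vs] by (auto simp: reverse_radial_gauss_image_def)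
  next
    fix u assume "u \<in> reverse_radial_gauss_image K \<eta>"
    then obtain v where u: "u \<in> sphere 0 1" "v \<in> \<eta>" "outer_unit_normal K (radial_fun K u *\<^sub>R u) v"
      by (auto simp: reverse_radial_gauss_image_def)
    then have "v \<bullet> (radial_fun K u *\<^sub>R u) = support_fun K v"
      using outer_unit_normal_iff[OF u(1)] assms by auto
    moreover have "u \<noteq> 0" "norm u = 1" using u by auto
    ultimately have *: "(radial_fun K u *\<^sub>R u, v) \<in> Z" "u = (radial_fun K u *\<^sub>R u) /\<^sub>R norm (radial_fun K u *\<^sub>R u)"
      using u radial_set(1)[of u] radial_pos[of u] by (auto simp: Z_def)
    show "u \<in> (\<lambda>z. fst z /\<^sub>R norm (fst z)) ` Z"
      by (rule image_eqI[OF _ *(1)]) (simp only: fst_conv *(2)[symmetric])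
  qed
  ultimately show ?thesis by simp
qed

lemma measurable_radial_fun: "radial_fun K \<in> borel_measurable spherical_measure"
proof (rule borel_measurable_iff_ge[THEN iffD2], intro allI)
  fix a :: real
  show "{w \<in> space spherical_measure. a \<le> radial_fun K w} \<in> sets spherical_measure"
  proof (cases "0 \<le> a")
    case True
    have "{w \<in> space spherical_measure. a \<le> radial_fun K w} = sphere 0 1 \<inter> {w. a *\<^sub>R w \<in> K}"
    proof (intro equalityI subsetI)
      fix w assume "w \<in> {w \<in> space spherical_measure. a \<le> radial_fun K w}"
      then show "w \<in> sphere 0 1 \<inter> {w. a *\<^sub>R w \<in> K}"
        using mem_iff_le_radial[of w a] True by (cases "w = 0") auto
    next
      fix w assume "w \<in> sphere 0 1 \<inter> {w. a *\<^sub>R w \<in> K}"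
      then show "w \<in> {w \<in> space spherical_measure. a \<le> radial_fun K w}"
        using mem_iff_le_radial[of w a] True by (cases "w = 0") auto
    qed
    moreover have "closed {w. a *\<^sub>R w \<in> K}"
      using continuous_closed_vimage[OF closed_K, of "\<lambda>w. a *\<^sub>R w"] by (auto simp: vimage_def)
    ultimately show ?thesis by (auto simp: sets_sphere_borel intro!: borel_closed closed_Int)
  next
    case False
    have "a \<le> radial_fun K w" if "w \<in> sphere 0 1" for w
      using radial_pos[of w] that False by (cases "w = 0") auto
    then have "{w \<in> space spherical_measure. a \<le> radial_fun K w} = space spherical_measure"
      by auto
    then show ?thesis by (metis sets.top)
  qed
qed

end

section \<open>The measure with density a power of the norm\<close>

text \<open>In polar coordinates this measure is \<open>r\<^sup>q\<^sup>-\<^sup>1 dr du\<close>. It turns \<open>\<integral> \<rho>\<^sup>q\<close> into the mass of a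
  genuine subset of space, which can be dilated, translated and covered. At the origin the value of
  \<open>powr\<close> is the default 0, on a null set.\<close>

definition radial_weight :: "real \<Rightarrow> 'a::euclidean_space measure" where
  "radial_weight q = density lborel (\<lambda>x. ennreal (norm x powr (q - DIM('a))))"

lemma space_radial_weight [simp]: "space (radial_weight q) = UNIV"
  and sets_radial_weight [simp, measurable_cong]: "sets (radial_weight q) = sets borel"
  by (simp_all add: radial_weight_def)

lemma emeasure_radial_weight:
  fixes A :: "'a::euclidean_space set"
  assumes "A \<in> sets borel"
  shows "emeasure (radial_weight q) A = (\<integral>\<^sup>+x. ennreal (norm x powr (q - DIM('a))) * indicator A x \<partial>lborel)"
  using assms by (simp add: radial_weight_def emeasure_density)

lemma emeasure_radial_weight_polar:
  fixes A :: "'a::euclidean_space set"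
  assumes [measurable]: "A \<in> sets borel"
  shows "emeasure (radial_weight q) A = (\<integral>\<^sup>+u. (\<integral>\<^sup>+r. ennreal (r powr (q - 1)) *
      indicator {r. 0 < r \<and> r *\<^sub>R u \<in> A} r \<partial>lborel) \<partial>spherical_measure)"
proof -
  have "emeasure (radial_weight q) A
      = (\<integral>\<^sup>+x. ennreal (norm x powr (q - DIM('a))) * indicator A x \<partial>lborel)"
    by (rule emeasure_radial_weight[OF assms])
  also have "\<dots> = (\<integral>\<^sup>+u. (\<integral>\<^sup>+r. ennreal (norm (r *\<^sub>R u) powr (q - DIM('a))) * indicator A (r *\<^sub>R u)
      \<partial>radial_lebesgue DIM('a)) \<partial>spherical_measure)"
    by (rule polar_coordinates) measurable
  also have "\<dots> = (\<integral>\<^sup>+u. (\<integral>\<^sup>+r. ennreal (r powr (q - 1)) *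
      indicator {r. 0 < r \<and> r *\<^sub>R u \<in> A} r \<partial>lborel) \<partial>spherical_measure)"
  proof (rule nn_integral_cong)
    fix u :: 'a assume "u \<in> space spherical_measure"
    then have u: "norm u = 1" by simp
    have e: "r ^ (DIM('a) - 1) * r powr (q - DIM('a)) = r powr (q - 1)" if "0 < r" for r :: real
    proof -
      have "r ^ (DIM('a) - 1) = r powr (real DIM('a) - 1)"
        using that by (simp add: powr_realpow[symmetric] of_nat_diff DIM_positive Suc_leI)
      then show ?thesis using that by (simp add: powr_add[symmetric])
    qed
    have "(\<integral>\<^sup>+r. ennreal (norm (r *\<^sub>R u) powr (q - DIM('a))) * indicator A (r *\<^sub>R u)
        \<partial>radial_lebesgue DIM('a)) = (\<integral>\<^sup>+r. (ennreal (r ^ (DIM('a) - 1)) * indicator {0<..} r) *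
          (ennreal (norm (r *\<^sub>R u) powr (q - DIM('a))) * indicator A (r *\<^sub>R u)) \<partial>lborel)"
      unfolding radial_lebesgue_def by (rule nn_integral_density) measurable
    also have "\<dots> = (\<integral>\<^sup>+r. ennreal (r powr (q - 1)) * indicator {r. 0 < r \<and> r *\<^sub>R u \<in> A} r \<partial>lborel)"
      by (rule nn_integral_cong) (use u e in \<open>auto simp: indicator_def ennreal_mult[symmetric]\<close>)
    finally show "(\<integral>\<^sup>+r. ennreal (norm (r *\<^sub>R u) powr (q - DIM('a))) * indicator A (r *\<^sub>R u)
        \<partial>radial_lebesgue DIM('a)) = (\<integral>\<^sup>+r. ennreal (r powr (q - 1)) *
          indicator {r. 0 < r \<and> r *\<^sub>R u \<in> A} r \<partial>lborel)" .
  qed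
  finally show ?thesis .
qed

lemma radial_integral_le:
  fixes q :: real
  assumes "1 \<le> q" "0 \<le> a" "a \<le> b" "b \<le> c" "\<And>r. r \<in> X \<Longrightarrow> 0 < r \<Longrightarrow> a \<le> r \<and> r \<le> b"
  shows "(\<integral>\<^sup>+r. ennreal (r powr (q - 1)) * indicator {r. 0 < r \<and> r \<in> X} r \<partial>lborel)
    \<le> ennreal ((b - a) * c powr (q - 1))"
proof -
  have "(\<integral>\<^sup>+r. ennreal (r powr (q - 1)) * indicator {r. 0 < r \<and> r \<in> X} r \<partial>lborel)
      \<le> (\<integral>\<^sup>+r. ennreal (c powr (q - 1)) * indicator {a..b} r \<partial>lborel)"
    using assms by (intro nn_integral_mono)
      (auto simp: indicator_def intro!: ennreal_leI powr_mono2 dest: order.trans)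
  also have "\<dots> = ennreal (c powr (q - 1)) * ennreal (b - a)"
    using assms by (subst nn_integral_cmult_indicator) auto
  also have "\<dots> = ennreal ((b - a) * c powr (q - 1))"
    using assms by (simp add: ennreal_mult[symmetric] mult.commute)
  finally show ?thesis .
qed

lemma radial_integral_ge:
  fixes q :: real
  assumes "1 \<le> q" "0 < a" "a \<le> b" "{a..b} \<subseteq> X" 
  shows "ennreal ((b - a) * a powr (q - 1))
    \<le> (\<integral>\<^sup>+r. ennreal (r powr (q - 1)) * indicator {r. 0 < r \<and> r \<in> X} r \<partial>lborel)"
proof -
  have "ennreal ((b - a) * a powr (q - 1)) = ennreal (a powr (q - 1)) * ennreal (b - a)"
    using assms by (simp add: ennreal_mult[symmetric] mult.commute)
  also have "\<dots> = (\<integral>\<^sup>+r. ennreal (a powr (q - 1)) * indicator {a..b} r \<partial>lborel)"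
    using assms by (subst nn_integral_cmult_indicator) auto
  also have "\<dots> \<le> (\<integral>\<^sup>+r. ennreal (r powr (q - 1)) * indicator {r. 0 < r \<and> r \<in> X} r \<partial>lborel)"
    using assms by (intro nn_integral_mono)
      (auto simp: indicator_def intro!: ennreal_leI powr_mono2 split: if_splits)
  finally show ?thesis .
qed

text \<open>Integrals over normals will be compared with integrals over radial directions through
  superlevel sets only. Counting the levels \<open>d, 2d, \<dots>\<close> below a value recovers it up to \<open>d\<close>.\<close>

lemma level_count:
  fixes g d :: real
  assumes "0 < d" "0 \<le> g" "g \<le> real N * d"
  shows "d * real (card {k\<in>{1..N}. real k * d \<le> g}) \<le> g"
    and "g \<le> d * real (card {k\<in>{1..N}. real k * d \<le> g}) + d"
proof -
  have "{k\<in>{1..N}. real k * d \<le> g} = {1..nat \<lfloor>g / d\<rfloor>}"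
  proof (intro equalityI subsetI)
    fix k assume "k \<in> {k\<in>{1..N}. real k * d \<le> g}"
    then show "k \<in> {1..nat \<lfloor>g / d\<rfloor>}"
      using assms by (auto simp: le_nat_floor pos_le_divide_eq)
  next
    fix k assume k: "k \<in> {1..nat \<lfloor>g / d\<rfloor>}"
    have "0 \<le> g / d" using assms by simp
    then have "real k \<le> g / d" using k by (simp add: le_nat_iff le_floor_iff)
    then have "real k * d \<le> g" using assms by (simp add: pos_le_divide_eq)
    moreover from this have "real k * d \<le> real N * d" using assms by linarith
    then have "k \<le> N" using assms by simp
    ultimately show "k \<in> {k\<in>{1..N}. real k * d \<le> g}" using k by simp
  qed
  then have c: "real (card {k\<in>{1..N}. real k * d \<le> g}) = real_of_int \<lfloor>g / d\<rfloor>" using assms by simp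
  have "real_of_int \<lfloor>g / d\<rfloor> * d \<le> g" "g \<le> (real_of_int \<lfloor>g / d\<rfloor> + 1) * d"
    using floor_divide_lower[OF assms(1), of g] floor_divide_upper[OF assms(1), of g] by auto
  then show "d * real (card {k\<in>{1..N}. real k * d \<le> g}) \<le> g"
    and "g \<le> d * real (card {k\<in>{1..N}. real k * d \<le> g}) + d"
    unfolding c by (simp_all add: algebra_simps)
qed

context body_around_origin
begin

abbreviation normal_at :: "'a \<Rightarrow> 'a \<Rightarrow> bool" where
  "normal_at u v \<equiv> outer_unit_normal K (radial_fun K u *\<^sub>R u) v"

definition dual_volume :: "real \<Rightarrow> ennreal" where
  "dual_volume q = (\<integral>\<^sup>+u. ennreal (radial_fun K u powr q) \<partial>spherical_measure)"

lemma measurable_radial_powr: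
  "(\<lambda>u. ennreal (radial_fun K u powr q)) \<in> borel_measurable spherical_measure"
  using measurable_radial_fun by measurable

text \<open>The ray in direction \<open>u\<close> meets \<open>K\<close> in the radii from \<open>0\<close> to \<open>\<rho>\<close>. Bounding \<open>r\<^sup>q\<^sup>-\<^sup>1\<close> by its values
  at \<open>\<rho>\<close> and at \<open>\<rho>/2\<close> compares both sides up to the factor \<open>2\<^sup>q\<close>, which is all that is needed.\<close>

lemma radial_weight_le_dual_volume:
  assumes "1 \<le> q" shows "emeasure (radial_weight q) K \<le> dual_volume q"
proof -
  have "emeasure (radial_weight q) K = (\<integral>\<^sup>+u. (\<integral>\<^sup>+r. ennreal (r powr (q - 1)) *
      indicator {r. 0 < r \<and> r \<in> {r. r *\<^sub>R u \<in> K}} r \<partial>lborel) \<partial>spherical_measure)"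
    using closed_K by (subst emeasure_radial_weight_polar) auto
  also have "\<dots> \<le> dual_volume q"
    unfolding dual_volume_def
  proof (rule nn_integral_mono)
    fix u :: 'a assume "u \<in> space spherical_measure"
    then have u: "u \<noteq> 0" by auto
    have r: "0 < radial_fun K u" by (rule radial_pos[OF u])
    have "(\<integral>\<^sup>+r. ennreal (r powr (q - 1)) * indicator {r. 0 < r \<and> r \<in> {r. r *\<^sub>R u \<in> K}} r \<partial>lborel)
        \<le> ennreal ((radial_fun K u - 0) * radial_fun K u powr (q - 1))"
      using r radial_set(2)[OF u] assms by (intro radial_integral_le) auto
    also have "(radial_fun K u - 0) * radial_fun K u powr (q - 1) = radial_fun K u powr q"
      using r by (simp add: powr_mult_base)
    finally show "(\<integral>\<^sup>+r. ennreal (r powr (q - 1)) * indicator {r. 0 < r \<and> r \<in> {r. r *\<^sub>R u \<in> K}} r \<partial>lborel)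
        \<le> ennreal (radial_fun K u powr q)" .
  qed
  finally show ?thesis .
qed

lemma dual_volume_le_radial_weight:
  assumes "1 \<le> q" shows "dual_volume q \<le> ennreal (2 powr q) * emeasure (radial_weight q) K"
proof -
  have "dual_volume q \<le> (\<integral>\<^sup>+u. ennreal (2 powr q) * (\<integral>\<^sup>+r. ennreal (r powr (q - 1)) *
      indicator {r. 0 < r \<and> r \<in> {r. r *\<^sub>R u \<in> K}} r \<partial>lborel) \<partial>spherical_measure)"
    unfolding dual_volume_def
  proof (rule nn_integral_mono)
    fix u :: 'a assume "u \<in> space spherical_measure"
    then have u: "u \<noteq> 0" by auto
    let ?\<rho> = "radial_fun K u"
    have r: "0 < ?\<rho>" by (rule radial_pos[OF u])
    have sub: "{?\<rho>/2..?\<rho>} \<subseteq> {r. r *\<^sub>R u \<in> K}"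
      using r mem_iff_le_radial[OF u] by auto
    have "?\<rho> powr q = 2 powr q * ((?\<rho> - ?\<rho>/2) * (?\<rho>/2) powr (q - 1))"
    proof -
      have "(?\<rho> - ?\<rho>/2) * (?\<rho>/2) powr (q - 1) = (?\<rho>/2) powr q"
        using powr_mult_base[of "?\<rho>/2" "q - 1"] r by simp
      then show ?thesis using r by (simp add: powr_divide)
    qed
    then have "ennreal (?\<rho> powr q) = ennreal (2 powr q) * ennreal ((?\<rho> - ?\<rho>/2) * (?\<rho>/2) powr (q - 1))"
      using r by (simp add: ennreal_mult[symmetric])
    also have "\<dots> \<le> ennreal (2 powr q) * (\<integral>\<^sup>+r. ennreal (r powr (q - 1)) *
        indicator {r. 0 < r \<and> r \<in> {r. r *\<^sub>R u \<in> K}} r \<partial>lborel)"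
      using r sub assms by (intro mult_left_mono radial_integral_ge) auto
    finally show "ennreal (?\<rho> powr q) \<le> ennreal (2 powr q) * (\<integral>\<^sup>+r. ennreal (r powr (q - 1)) *
        indicator {r. 0 < r \<and> r \<in> {r. r *\<^sub>R u \<in> K}} r \<partial>lborel)" .
  qed
  also have "\<dots> = ennreal (2 powr q) * (\<integral>\<^sup>+u. (\<integral>\<^sup>+r. ennreal (r powr (q - 1)) *
      indicator {r. 0 < r \<and> r \<in> {r. r *\<^sub>R u \<in> K}} r \<partial>lborel) \<partial>spherical_measure)"
  proof (rule nn_integral_cmult)
    have [measurable]: "K \<in> sets borel" using closed_K by auto
    have [measurable]: "(\<lambda>x::'a. x) \<in> measurable spherical_measure borel"
      by (subst measurable_cong_sets[OF sets_spherical_measure refl]) (rule measurable_restrict_space1, simp)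
    have [measurable]: "Measurable.pred (spherical_measure \<Otimes>\<^sub>M borel) (\<lambda>z. snd z *\<^sub>R fst z \<in> K)"
      by measurable
    show "(\<lambda>u. \<integral>\<^sup>+r. ennreal (r powr (q - 1)) *
        indicator {r. 0 < r \<and> r \<in> {r. r *\<^sub>R u \<in> K}} r \<partial>lborel) \<in> borel_measurable spherical_measure"
      unfolding indicator_def mem_Collect_eq by measurable
  qed
  also have "(\<integral>\<^sup>+u. (\<integral>\<^sup>+r. ennreal (r powr (q - 1)) *
      indicator {r. 0 < r \<and> r \<in> {r. r *\<^sub>R u \<in> K}} r \<partial>lborel) \<partial>spherical_measure) = emeasure (radial_weight q) K"
    using closed_K by (subst emeasure_radial_weight_polar) auto
  finally show ?thesis .
qed

lemma dual_volume_le: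
  assumes "0 \<le> q" "\<And>x. x \<in> K \<Longrightarrow> norm x \<le> R" 
  shows "dual_volume q \<le> ennreal (R powr q) * emeasure spherical_measure (sphere 0 (1::real) :: 'a set)"
proof -
  have "dual_volume q \<le> (\<integral>\<^sup>+u. ennreal (R powr q) \<partial>(spherical_measure :: 'a measure))"
    unfolding dual_volume_def
  proof (rule nn_integral_mono)
    fix u :: 'a assume "u \<in> space spherical_measure"
    then have u: "u \<in> sphere 0 1" "u \<noteq> 0" by auto
    show "ennreal (radial_fun K u powr q) \<le> ennreal (R powr q)"
      using radial_le[OF u(1) assms(2)] radial_pos[OF u(2)] assms by (intro ennreal_leI powr_mono2) auto
  qed
  then show ?thesis by simp
qed

end

section \<open>The first variation\<close>

context body_around_origin
begin

lemma gauss_image_sets: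
  assumes "closed \<eta>" "\<eta> \<subseteq> sphere 0 1"
  shows "reverse_radial_gauss_image K \<eta> \<in> sets spherical_measure"
  using compact_reverse_radial_gauss_image[OF assms]
  by (auto simp: sets_sphere_borel reverse_radial_gauss_image_def intro: borel_closed compact_imp_closed)

text \<open>A set lying just outside \<open>K\<close>, no further than a relative distance \<open>t g(v)\<close> beyond the boundary
  point with normal \<open>v\<close>, has weight at most \<open>O(t) \<integral> g dM\<close>, where \<open>M\<close> is the dual curvature measure.
  The normal need not be unique and the reverse radial Gauss image of a Borel set need not be Borel;
  the images of the closed superlevel sets of \<open>g\<close> are compact, so \<open>g\<close> is first replaced by a step
  function with steps \<open>d\<close>, and \<open>d\<close> tends to 0 at the end.\<close>

lemma first_variation:
  fixes g :: "'a \<Rightarrow> real"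
  assumes q: "1 \<le> q"
    and M: "sets M = sets sphere_borel"
      "\<And>\<eta>. closed \<eta> \<Longrightarrow> \<eta> \<subseteq> sphere 0 1 \<Longrightarrow> emeasure M \<eta> =
        (\<integral>\<^sup>+u\<in>reverse_radial_gauss_image K \<eta>. ennreal (radial_fun K u powr q) \<partial>spherical_measure)"
    and g: "\<And>v. v \<in> sphere 0 1 \<Longrightarrow> 0 \<le> g v" "\<And>v. v \<in> sphere 0 1 \<Longrightarrow> g v \<le> B"
      "\<And>c. 0 < c \<Longrightarrow> closed {v \<in> sphere 0 1. c \<le> g v}"
    and t: "0 < t" "t * B \<le> 1"
    and A: "A \<in> sets borel" "\<And>r u. u \<in> sphere 0 1 \<Longrightarrow> 0 < r \<Longrightarrow> r *\<^sub>R u \<in> A \<Longrightarrow>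
      \<exists>v\<in>sphere 0 1. normal_at u v \<and> radial_fun K u \<le> r \<and> r \<le> radial_fun K u * (1 + t * g v)"
    and fin: "dual_volume q < \<infinity>"
  shows "emeasure (radial_weight q) A \<le> ennreal (2 powr q * t) * (\<integral>\<^sup>+v. ennreal (g v) \<partial>M)"
proof -
  have B: "0 \<le> B"
  proof -
    obtain b :: 'a where "b \<in> Basis" using nonempty_Basis by blast
    then have "b \<in> sphere 0 1" by simp
    from g(1,2)[OF this] show ?thesis by linarith
  qed
  have spM: "space M = sphere 0 1" using sets_eq_imp_space_eq[OF M(1)] by (simp add: space_restrict_space)
  have approx: "emeasure (radial_weight q) A
      \<le> ennreal (2 powr q * t) * ((\<integral>\<^sup>+v. ennreal (g v) \<partial>M) + ennreal d * dual_volume q)"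
    if d: "0 < d" for d
  proof -
    obtain N :: nat where N: "B \<le> real N * d"
      using ex_less_of_nat_mult[OF d, of B] by (auto intro: less_imp_le)
    define E where "E k = {v \<in> sphere 0 1. real k * d \<le> g v}" for k :: nat
    define \<A> where "\<A> k = reverse_radial_gauss_image K (E k)" for k
    have E: "closed (E k)" "E k \<subseteq> sphere 0 1" if "k \<in> {1..N}" for k
      using that d g(3)[of "real k * d"] by (auto simp: E_def)
    have \<A>: "\<A> k \<in> sets spherical_measure" if "k \<in> {1..N}" for k
      unfolding \<A>_def by (rule gauss_image_sets[OF E[OF that]])
    let ?\<rho> = "radial_fun K"
    have "emeasure (radial_weight q) A = (\<integral>\<^sup>+u. (\<integral>\<^sup>+r. ennreal (r powr (q - 1)) *
        indicator {r. 0 < r \<and> r \<in> {r. r *\<^sub>R u \<in> A}} r \<partial>lborel) \<partial>spherical_measure)"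
      using A(1) by (subst emeasure_radial_weight_polar) auto
    also have "\<dots> \<le> (\<integral>\<^sup>+u. ennreal (2 powr q * t) * (ennreal (?\<rho> u powr q) *
        (ennreal d + (\<Sum>k\<in>{1..N}. ennreal d * indicator (\<A> k) u))) \<partial>spherical_measure)"
    proof (rule nn_integral_mono)
      fix u :: 'a assume "u \<in> space spherical_measure"
      then have u: "u \<in> sphere 0 1" "u \<noteq> 0" by auto
      have r: "0 < ?\<rho> u" by (rule radial_pos[OF u(2)])
      \<comment> \<open>\<open>s\<close> bounds \<open>g v\<close> for every normal \<open>v\<close> at the boundary point in direction \<open>u\<close>.\<close>
      define c where "c = card {k\<in>{1..N}. u \<in> \<A> k}"
      define s where "s = d * real c + d"
      have s: "0 < s" using d by (simp add: s_def add_nonneg_pos)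
      have X: "?\<rho> u \<le> r \<and> r \<le> min (2 * ?\<rho> u) (?\<rho> u * (1 + t * s))"
        if rA: "r \<in> {r. r *\<^sub>R u \<in> A}" and rpos: "0 < r" for r
      proof -
        obtain v where v: "v \<in> sphere 0 1" "normal_at u v" "?\<rho> u \<le> r" "r \<le> ?\<rho> u * (1 + t * g v)"
          using A(2)[OF u(1) rpos] rA by blast
        have "t * g v \<le> t * B" using g(2)[OF v(1)] t by (intro mult_left_mono) auto
        then have "t * g v \<le> 1" using t by linarith
        then have "?\<rho> u * (1 + t * g v) \<le> ?\<rho> u * 2" using r by (intro mult_left_mono) auto
        then have 1: "r \<le> 2 * ?\<rho> u" using v(4) by linarith
        have "{k\<in>{1..N}. real k * d \<le> g v} \<subseteq> {k\<in>{1..N}. u \<in> \<A> k}"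
          using u v by (auto simp: \<A>_def reverse_radial_gauss_image_def E_def)
        then have "card {k\<in>{1..N}. real k * d \<le> g v} \<le> c"
          unfolding c_def by (rule card_mono[rotated]) simp
        then have "d * real (card {k\<in>{1..N}. real k * d \<le> g v}) \<le> d * real c"
          using d by (intro mult_left_mono) auto
        moreover have "g v \<le> d * real (card {k\<in>{1..N}. real k * d \<le> g v}) + d"
          using g(1,2)[OF v(1)] N d by (intro level_count(2)) auto
        ultimately have "g v \<le> s" by (simp add: s_def)
        then have "?\<rho> u * (1 + t * g v) \<le> ?\<rho> u * (1 + t * s)"
          using r t by (intro mult_left_mono add_left_mono) auto
        with 1 v show ?thesis by simp
      qed
      have "(\<integral>\<^sup>+r. ennreal (r powr (q - 1)) * indicator {r. 0 < r \<and> r \<in> {r. r *\<^sub>R u \<in> A}} r \<partial>lborel)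
          \<le> ennreal ((min (2 * ?\<rho> u) (?\<rho> u * (1 + t * s)) - ?\<rho> u) * (2 * ?\<rho> u) powr (q - 1))"
        using r s t q X by (intro radial_integral_le) (auto simp: distrib_left)
      also have "\<dots> \<le> ennreal (2 powr q * t * (?\<rho> u powr q * s))"
      proof (rule ennreal_leI)
        have "(min (2 * ?\<rho> u) (?\<rho> u * (1 + t * s)) - ?\<rho> u) * (2 * ?\<rho> u) powr (q - 1)
            \<le> (?\<rho> u * t * s) * (2 * ?\<rho> u) powr (q - 1)"
          using r by (intro mult_right_mono) (auto simp: algebra_simps min_def)
        also have "\<dots> = 2 powr (q - 1) * t * (?\<rho> u powr q * s)"
          using r powr_mult_base[of "?\<rho> u" "q - 1"] by (simp add: powr_mult)
        also have "\<dots> \<le> 2 powr q * t * (?\<rho> u powr q * s)"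
          using s t by (intro mult_right_mono) auto
        finally show "(min (2 * ?\<rho> u) (?\<rho> u * (1 + t * s)) - ?\<rho> u) * (2 * ?\<rho> u) powr (q - 1)
            \<le> 2 powr q * t * (?\<rho> u powr q * s)" .
      qed
      also have "\<dots> = ennreal (2 powr q * t) * (ennreal (?\<rho> u powr q) * ennreal s)"
        using t s by (simp add: ennreal_mult[symmetric])
      also have "ennreal s = ennreal d + (\<Sum>k\<in>{1..N}. ennreal d * indicator (\<A> k) u)"
      proof -
        have "(\<Sum>k\<in>{1..N}. ennreal d * indicator (\<A> k) u) = (\<Sum>k\<in>{k\<in>{1..N}. u \<in> \<A> k}. ennreal d)"
          by (rule sum.mono_neutral_cong_right) auto
        also have "\<dots> = ennreal (d * real c)"
          using d by (simp add: c_def ennreal_mult ennreal_of_nat_eq_real_of_nat[symmetric] mult.commute)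
        finally show ?thesis using d by (simp add: s_def add.commute)
      qed
      finally show "(\<integral>\<^sup>+r. ennreal (r powr (q - 1)) * indicator {r. 0 < r \<and> r \<in> {r. r *\<^sub>R u \<in> A}} r \<partial>lborel)
          \<le> ennreal (2 powr q * t) * (ennreal (?\<rho> u powr q) *
            (ennreal d + (\<Sum>k\<in>{1..N}. ennreal d * indicator (\<A> k) u)))" .
    qed
    also have "\<dots> = (\<integral>\<^sup>+u. ennreal (2 powr q * t) * (ennreal d * ennreal (?\<rho> u powr q) +
        (\<Sum>k\<in>{1..N}. ennreal d * (ennreal (?\<rho> u powr q) * indicator (\<A> k) u))) \<partial>spherical_measure)"
      by (intro nn_integral_cong) (simp only: distrib_left sum_distrib_left mult_ac)
    also have "\<dots> = ennreal (2 powr q * t) * (ennreal d * dual_volume q + (\<Sum>k\<in>{1..N}. ennreal d *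
        (\<integral>\<^sup>+u. ennreal (?\<rho> u powr q) * indicator (\<A> k) u \<partial>spherical_measure)))"
    proof -
      have m: "(\<lambda>u. ennreal (?\<rho> u powr q) * indicator (\<A> k) u) \<in> borel_measurable spherical_measure"
        if "k \<in> {1..N}" for k
        by (intro borel_measurable_times_ennreal measurable_radial_powr borel_measurable_indicator \<A>[OF that])
      have m': "(\<lambda>u. ennreal d * (ennreal (?\<rho> u powr q) * indicator (\<A> k) u)) \<in> borel_measurable spherical_measure"
        if "k \<in> {1..N}" for k
        by (intro borel_measurable_times_ennreal borel_measurable_const m that)
      have m0: "(\<lambda>u. ennreal d * ennreal (?\<rho> u powr q)) \<in> borel_measurable spherical_measure"
        by (intro borel_measurable_times_ennreal borel_measurable_const measurable_radial_powr)
      have ms: "(\<lambda>u. \<Sum>k\<in>{1..N}. ennreal d * (ennreal (?\<rho> u powr q) * indicator (\<A> k) u))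
          \<in> borel_measurable spherical_measure"
        by (rule borel_measurable_sum[OF m'])
      have "(\<integral>\<^sup>+u. (\<Sum>k\<in>{1..N}. ennreal d * (ennreal (?\<rho> u powr q) * indicator (\<A> k) u)) \<partial>spherical_measure)
          = (\<Sum>k\<in>{1..N}. ennreal d * (\<integral>\<^sup>+u. ennreal (?\<rho> u powr q) * indicator (\<A> k) u \<partial>spherical_measure))"
        by (subst nn_integral_sum[OF m']) (auto intro!: sum.cong nn_integral_cmult m)
      moreover have "(\<integral>\<^sup>+u. ennreal d * ennreal (?\<rho> u powr q) \<partial>spherical_measure) = ennreal d * dual_volume q"
        unfolding dual_volume_def by (rule nn_integral_cmult[OF measurable_radial_powr])
      ultimately show ?thesis
        by (subst nn_integral_cmult[OF borel_measurable_add[OF m0 ms]], subst nn_integral_add[OF m0 ms])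
           (simp only:)
    qed
    also have "(\<Sum>k\<in>{1..N}. ennreal d *
        (\<integral>\<^sup>+u. ennreal (?\<rho> u powr q) * indicator (\<A> k) u \<partial>spherical_measure))
        = (\<Sum>k\<in>{1..N}. ennreal d * emeasure M (E k))"
      using M(2)[OF E] by (intro sum.cong) (auto simp: \<A>_def)
    also have "\<dots> = (\<integral>\<^sup>+v. (\<Sum>k\<in>{1..N}. ennreal d * indicator (E k) v) \<partial>M)"
    proof -
      have [measurable]: "E k \<in> sets M" if "k \<in> {1..N}" for k
        using E[OF that] unfolding M(1) by (auto simp: sets_sphere_borel)
      show ?thesis by (subst nn_integral_sum) (auto simp: nn_integral_cmult_indicator)
    qed
    also have "\<dots> \<le> (\<integral>\<^sup>+v. ennreal (g v) \<partial>M)"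
    proof (rule nn_integral_mono)
      fix v assume "v \<in> space M"
      then have v: "v \<in> sphere 0 1" by (simp add: spM)
      have "(\<Sum>k\<in>{1..N}. ennreal d * indicator (E k) v) = (\<Sum>k\<in>{k\<in>{1..N}. real k * d \<le> g v}. ennreal d)"
        using v by (intro sum.mono_neutral_cong_right) (auto simp: E_def)
      also have "\<dots> = ennreal (d * real (card {k\<in>{1..N}. real k * d \<le> g v}))"
        using d by (simp add: ennreal_mult ennreal_of_nat_eq_real_of_nat[symmetric] mult.commute)
      also have "\<dots> \<le> ennreal (g v)"
        using g(1,2)[OF v] N d by (intro ennreal_leI level_count(1)) auto
      finally show "(\<Sum>k\<in>{1..N}. ennreal d * indicator (E k) v) \<le> ennreal (g v)" .
    qed
    finally show ?thesis by (simp add: add.commute mult_left_mono)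
  qed
  show ?thesis
  proof (rule ennreal_le_epsilon)
    fix e :: real assume "0 < e"
    obtain m where m: "dual_volume q = ennreal m" "0 \<le> m" using fin by (cases "dual_volume q") auto
    define c where "c = 2 powr q * t * m + 1"
    have c: "0 < c" "2 powr q * t * m \<le> c" using t m by (simp_all add: c_def add_nonneg_pos)
    define d where "d = e / c"
    have d: "0 < d" "c * d = e" using \<open>0 < e\<close> c by (simp_all add: d_def)
    have "emeasure (radial_weight q) A \<le> ennreal (2 powr q * t) * (\<integral>\<^sup>+v. ennreal (g v) \<partial>M)
        + ennreal (2 powr q * t) * (ennreal d * dual_volume q)"
      using approx[OF d(1)] by (simp add: distrib_left)
    moreover have "ennreal (2 powr q * t) * (ennreal d * dual_volume q) = ennreal (2 powr q * t * m * d)"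
      using m t d by (simp add: ennreal_mult[symmetric] mult_ac)
    moreover have "ennreal (2 powr q * t * m * d) \<le> ennreal e"
      using c d mult_right_mono[of "2 powr q * t * m" c d] by (intro ennreal_leI) simp
    ultimately show "emeasure (radial_weight q) A
        \<le> ennreal (2 powr q * t) * (\<integral>\<^sup>+v. ennreal (g v) \<partial>M) + ennreal e"
      by (simp only:) (erule order.trans, rule add_left_mono)
  qed
qed

text \<open>A point \<open>r u\<close> of \<open>K + t Q\<close> cannot lie beyond the hyperplane supporting \<open>K\<close> at
  \<open>\<rho>\<^sub>K(u) u\<close>, moved outwards by \<open>t h\<^sub>Q\<close>.\<close>

lemma radius_of_sum_le:
  assumes u: "u \<in> sphere 0 1" and v: "v \<in> sphere 0 1" "normal_at u v"
    and Q: "bounded Q" and r: "r *\<^sub>R u = y + t *\<^sub>R z" "y \<in> K" "z \<in> Q" and t: "0 \<le> t"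
  shows "r \<le> radial_fun K u * (1 + t * (support_fun Q v / support_fun K v))"
proof -
  have vn: "v \<noteq> 0" and un: "u \<noteq> 0" using v u by auto
  have h: "0 < support_fun K v" by (rule support_pos[OF vn])
  have n: "radial_fun K u * (v \<bullet> u) = support_fun K v"
    using outer_unit_normal_iff[OF u v(1)] v(2) by simp
  have vu: "0 < v \<bullet> u" using h n radial_pos[OF un] by (metis zero_less_mult_pos)
  have "r * (v \<bullet> u) = v \<bullet> y + t * (v \<bullet> z)"
    using arg_cong[OF r(1), of "\<lambda>x. v \<bullet> x"] by (simp add: inner_add_right)
  also have "\<dots> \<le> support_fun K v + t * support_fun Q v"
    using t by (intro add_mono mult_left_mono support_fun_ge bounded_K Q r)
  also have "\<dots> = support_fun K v * (1 + t * (support_fun Q v / support_fun K v))"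
    using h by (simp add: distrib_left)
  also have "\<dots> = radial_fun K u * (1 + t * (support_fun Q v / support_fun K v)) * (v \<bullet> u)"
    by (simp add: n[symmetric] mult_ac)
  finally show ?thesis using vu by simp
qed

end

section \<open>Bodies with pinched dual curvature\<close>

definition sphere_area :: "'a::euclidean_space itself \<Rightarrow> real" where
  "sphere_area _ = measure (spherical_measure :: 'a measure) (sphere 0 1)"

definition cap_area :: "'a::euclidean_space itself \<Rightarrow> real" where
  "cap_area _ = real DIM('a) * measure lborel (ball (0::'a) (1/4))"

lemma emeasure_sphere: "emeasure spherical_measure (sphere 0 1 :: 'a::euclidean_space set) = ennreal (sphere_area TYPE('a))"
  using emeasure_spherical_measure_finite[of "sphere 0 1 :: 'a set"]
  by (simp add: sphere_area_def emeasure_eq_ennreal_measure)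

lemma cap_area_pos: "0 < cap_area TYPE('a::euclidean_space)"
  using content_ball_pos[of "1/4" "0::'a"] by (simp add: cap_area_def)

text \<open>The cone over a cap of angular radius \<open>\<pi>/3\<close> contains the ball of radius \<open>1/4\<close> around
  \<open>3/4\<close> of its axis.\<close>

lemma cap_area_le:
  fixes e :: "'a::euclidean_space"
  assumes "norm e = 1"
  shows "ennreal (cap_area TYPE('a)) \<le> emeasure spherical_measure {v \<in> sphere 0 1. 1/2 \<le> v \<bullet> e}"
proof -
  have "closed {v \<in> sphere (0::'a) 1. 1/2 \<le> v \<bullet> e}"
    unfolding Collect_conj_eq Collect_mem_eq
    by (intro closed_Int closed_sphere closed_Collect_le continuous_intros)
  then have S: "{v \<in> sphere 0 1. 1/2 \<le> v \<bullet> e} \<in> sets sphere_borel"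
    by (auto simp: sets_sphere_borel)
  have sub: "ball ((3/4) *\<^sub>R e) (1/4)
      \<subseteq> {x. x \<noteq> 0 \<and> norm x \<le> 1 \<and> x /\<^sub>R norm x \<in> {v \<in> sphere 0 1. 1/2 \<le> v \<bullet> e}}"
  proof
    fix x assume "x \<in> ball ((3/4) *\<^sub>R e) (1/4)"
    then have d: "norm ((3/4) *\<^sub>R e - x) < 1/4" by (simp add: dist_norm)
    have "((3/4) *\<^sub>R e - x) \<bullet> e \<le> norm ((3/4) *\<^sub>R e - x) * norm e" by (rule norm_cauchy_schwarz)
    then have xe: "1/2 < x \<bullet> e" using d assms by (simp add: inner_diff_left dot_square_norm)
    have "norm x \<le> norm ((3/4) *\<^sub>R e) + norm ((3/4) *\<^sub>R e - x)" by (metis norm_triangle_sub norm_minus_commute)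
    then have nx: "norm x \<le> 1" using d assms by simp
    have x0: "0 < norm x" using xe by auto
    have "1/2 \<le> (x \<bullet> e) / norm x" using xe nx x0 by (simp add: field_simps)
    also have "(x \<bullet> e) / norm x = (x /\<^sub>R norm x) \<bullet> e" by (simp add: divide_inverse_commute)
    finally have "x /\<^sub>R norm x \<in> {v \<in> sphere 0 1. 1/2 \<le> v \<bullet> e}" using x0 by simp
    then show "x \<in> {x. x \<noteq> 0 \<and> norm x \<le> 1 \<and> x /\<^sub>R norm x \<in> {v \<in> sphere 0 1. 1/2 \<le> v \<bullet> e}}"
      using x0 nx by simp
  qed
  have [measurable]: "{v \<in> sphere 0 1. 1/2 \<le> v \<bullet> e} \<in> sets borel" using S by (simp add: sets_sphere_borel)
  have bm: "{x. x \<noteq> 0 \<and> norm x \<le> 1 \<and> x /\<^sub>R norm x \<in> {v \<in> sphere 0 1. 1/2 \<le> v \<bullet> e}} \<in> sets borel"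
    by measurable
  have "ennreal (cap_area TYPE('a)) = of_nat DIM('a) * emeasure lborel (ball ((3/4) *\<^sub>R e) (1/4))"
  proof -
    have "measure lborel (ball (0::'a) (1/4)) = measure lborel (ball ((3/4) *\<^sub>R e) (1/4))"
      by (simp add: content_ball)
    then show ?thesis
      using emeasure_lborel_ball_finite[of "(3/4) *\<^sub>R e" "1/4"]
      by (simp add: cap_area_def ennreal_mult ennreal_of_nat_eq_real_of_nat emeasure_eq_ennreal_measure)
  qed
  also have "\<dots> \<le> of_nat DIM('a) * emeasure lborel
      {x. x \<noteq> 0 \<and> norm x \<le> 1 \<and> x /\<^sub>R norm x \<in> {v \<in> sphere 0 1. 1/2 \<le> v \<bullet> e}}"
    using sub bm by (intro mult_left_mono emeasure_mono) auto
  also have "\<dots> = emeasure spherical_measure {v \<in> sphere 0 1. 1/2 \<le> v \<bullet> e}"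
    by (rule emeasure_spherical_measure[OF S, symmetric])
  finally show ?thesis .
qed

lemma sphere_area_pos: "0 < sphere_area TYPE('a::euclidean_space)"
proof -
  obtain b :: 'a where "b \<in> Basis" using nonempty_Basis by blast
  then have "ennreal (cap_area TYPE('a)) \<le> emeasure spherical_measure {v \<in> sphere 0 1. 1/2 \<le> v \<bullet> b}"
    by (intro cap_area_le) simp
  also have "\<dots> \<le> emeasure spherical_measure (sphere 0 1 :: 'a set)"
  proof (rule emeasure_mono)
    show "sphere 0 1 \<in> sets (spherical_measure :: 'a measure)" by (simp add: sets_sphere_borel)
  qed auto
  finally show ?thesis
    using cap_area_pos[where ?'a='a] unfolding emeasure_sphere by (metis ennreal_le_iff2 not_le less_le_trans)
qed

text \<open>The constants of the theorem come from estimates for one body whose \<open>L\<^sub>p\<close> dual curvature measure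
  is pinched between multiples of spherical Lebesgue measure.\<close>

locale pinched_curvature = body_around_origin K for K :: "'a::euclidean_space set" +
  fixes p q l :: real
  assumes q_ge: "1 \<le> q" and q_le: "q \<le> DIM('a)" and p_pos: "0 < p" and l_pos: "0 < l"
    and pinched: "\<And>\<eta>. \<eta> \<in> sets sphere_borel \<Longrightarrow>
        ennreal (1 / l) * emeasure spherical_measure \<eta> \<le> emeasure (Lp_dual_curvature p q K) \<eta>"
      "\<And>\<eta>. \<eta> \<in> sets sphere_borel \<Longrightarrow>
        emeasure (Lp_dual_curvature p q K) \<eta> \<le> ennreal l * emeasure spherical_measure \<eta>"
begin

abbreviation "h \<equiv> support_fun K"

lemma measurable_support_fun:
  assumes "compact Q" "Q \<noteq> {}" shows "support_fun Q \<in> borel_measurable (sphere_borel :: 'a measure)"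
  using assms by (intro measurable_restrict_space1 borel_measurable_continuous_onI continuous_on_support_fun)

lemma sets_dual_curvature: "sets (dual_curvature q K) = sets sphere_borel"
  using sets.sigma_sets_eq[of "sphere_borel :: 'a measure"] sets.space_closed[of "sphere_borel :: 'a measure"]
  unfolding dual_curvature_def by (subst sets_measure_of) (simp_all add: space_restrict_space)

lemma space_dual_curvature: "space (dual_curvature q K) = sphere 0 1"
  using sets_eq_imp_space_eq[OF sets_dual_curvature] by (simp add: space_restrict_space)

lemma measurable_dual_curvature: "f \<in> borel_measurable (dual_curvature q K) \<longleftrightarrow> f \<in> borel_measurable sphere_borel"
  by (rule arg_cong[where f="\<lambda>X. f \<in> X", OF measurable_cong_sets[OF sets_dual_curvature refl]])

lemma measurable_density: "(\<lambda>v. ennreal (h v powr (- p))) \<in> borel_measurable (dual_curvature q K)"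
  unfolding measurable_dual_curvature using measurable_support_fun[OF compact_K nonempty] by measurable

text \<open>If the set function defining the dual curvature measure were not a measure, the associated
  measure would vanish identically, against the lower bound.\<close>

lemma emeasure_dual_curvature:
  assumes "\<eta> \<in> sets sphere_borel"
  shows "emeasure (dual_curvature q K) \<eta> = (\<integral>\<^sup>+u\<in>reverse_radial_gauss_image K \<eta>.
      ennreal (radial_fun K u powr q) \<partial>completion spherical_measure)"
proof -
  let ?\<mu> = "\<lambda>\<eta>. \<integral>\<^sup>+u\<in>reverse_radial_gauss_image K \<eta>. ennreal (radial_fun K u powr q)
      \<partial>completion spherical_measure"
  let ?B = "sets (sphere_borel :: 'a measure)"
  have B: "?B \<subseteq> Pow (sphere 0 1)"
    using sets.space_closed[of "sphere_borel :: 'a measure"] by (simp add: space_restrict_space)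
  have ss: "sigma_sets (sphere 0 1) ?B = ?B"
    using sets.sigma_sets_eq[of "sphere_borel :: 'a measure"] by (simp add: space_restrict_space)
  have "measure_space (sphere 0 1) (sigma_sets (sphere 0 1) ?B) ?\<mu>"
  proof (rule ccontr)
    assume "\<not> ?thesis"
    then have "emeasure (dual_curvature q K) X = 0" for X
      unfolding dual_curvature_def by (simp add: emeasure_measure_of_conv)
    then have "sphere 0 1 \<in> null_sets (dual_curvature q K)"
      by (auto simp: sets_dual_curvature sets_sphere_borel)
    then have "sphere 0 1 \<in> null_sets (Lp_dual_curvature p q K)"
      using absolutely_continuousI_density[OF measurable_density]
      unfolding Lp_dual_curvature_def absolutely_continuous_def by auto
    then have "ennreal (1 / l) * emeasure spherical_measure (sphere 0 1 :: 'a set) \<le> 0"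
      using pinched(1)[of "sphere 0 1"] by (auto simp: sets_sphere_borel)
    then show False
      using l_pos sphere_area_pos[where ?'a='a] by (simp add: emeasure_sphere ennreal_mult[symmetric])
  qed
  then show ?thesis
    using assms unfolding dual_curvature_def by (simp add: emeasure_measure_of_conv ss)
qed

lemma emeasure_dual_curvature_closed:
  assumes "closed \<eta>" "\<eta> \<subseteq> sphere 0 1"
  shows "emeasure (dual_curvature q K) \<eta> = (\<integral>\<^sup>+u\<in>reverse_radial_gauss_image K \<eta>.
      ennreal (radial_fun K u powr q) \<partial>spherical_measure)"
  using assms by (subst emeasure_dual_curvature) (auto simp: sets_sphere_borel nn_integral_completion)

lemma dual_volume_eq: "dual_volume q = (\<integral>\<^sup>+v. 1 \<partial>dual_curvature q K)"
proof -
  have "reverse_radial_gauss_image K (sphere 0 1) = sphere 0 1"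
    unfolding reverse_radial_gauss_image_def using ex_normal by blast
  then have "(\<integral>\<^sup>+u\<in>reverse_radial_gauss_image K (sphere 0 1). ennreal (radial_fun K u powr q)
      \<partial>spherical_measure) = dual_volume q"
    unfolding dual_volume_def by (intro nn_integral_cong) auto
  then show ?thesis
    using emeasure_dual_curvature_closed[of "sphere 0 1"] by (simp add: space_dual_curvature)
qed

text \<open>The dual curvature measure is \<open>h\<^sup>p\<close> times the \<open>L\<^sub>p\<close> one, so pinching makes it comparable with
  \<open>h\<^sup>p\<close> times spherical measure.\<close>

lemma nn_integral_dual_curvature:
  assumes f: "f \<in> borel_measurable sphere_borel"
  shows "(\<integral>\<^sup>+v. f v \<partial>dual_curvature q K) = (\<integral>\<^sup>+v. f v * ennreal (h v powr p) \<partial>Lp_dual_curvature p q K)"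
proof -
  have m: "(\<lambda>v. f v * ennreal (h v powr p)) \<in> borel_measurable (dual_curvature q K)"
    unfolding measurable_dual_curvature using f measurable_support_fun[OF compact_K nonempty] by measurable
  have "(\<integral>\<^sup>+v. f v * ennreal (h v powr p) \<partial>Lp_dual_curvature p q K)
      = (\<integral>\<^sup>+v. ennreal (h v powr (- p)) * (f v * ennreal (h v powr p)) \<partial>dual_curvature q K)"
    unfolding Lp_dual_curvature_def by (rule nn_integral_density[OF measurable_density m])
  also have "\<dots> = (\<integral>\<^sup>+v. f v \<partial>dual_curvature q K)"
  proof (rule nn_integral_cong)
    fix v assume "v \<in> space (dual_curvature q K)"
    then have "v \<noteq> 0" by (auto simp: space_dual_curvature)
    then have "0 < h v" by (rule support_pos)
    then have "ennreal (h v powr (- p)) * ennreal (h v powr p) = 1"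
      by (simp add: ennreal_mult[symmetric] powr_add[symmetric])
    then show "ennreal (h v powr (- p)) * (f v * ennreal (h v powr p)) = f v"
      by (metis mult.assoc mult.commute mult.right_neutral)
  qed
  finally show ?thesis ..
qed

lemma sets_Lp: "sets (Lp_dual_curvature p q K) = sets sphere_borel"
  unfolding Lp_dual_curvature_def by (simp add: sets_dual_curvature)

lemma nn_integral_Lp_le:
  assumes "f \<in> borel_measurable sphere_borel"
  shows "(\<integral>\<^sup>+v. f v \<partial>Lp_dual_curvature p q K) \<le> ennreal l * (\<integral>\<^sup>+v. f v \<partial>spherical_measure)"
proof -
  have f: "f \<in> borel_measurable spherical_measure"
    using assms by (simp cong: measurable_cong_sets)
  have eq: "sets (Lp_dual_curvature p q K) = sets (scale_measure (ennreal l) spherical_measure)"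
    by (simp add: sets_Lp)
  have "Lp_dual_curvature p q K \<le> scale_measure (ennreal l) spherical_measure"
    unfolding le_measure_iff using eq sets_eq_imp_space_eq[OF eq]
  proof (simp add: le_fun_def, intro allI)
    fix \<eta> show "emeasure (Lp_dual_curvature p q K) \<eta> \<le> ennreal l * emeasure spherical_measure \<eta>"
      using pinched(2)[of \<eta>] by (cases "\<eta> \<in> sets sphere_borel") (simp_all add: emeasure_notin_sets sets_Lp)
  qed
  from nn_integral_mono_measure[OF eq this, of f] show ?thesis
    by (simp add: nn_integral_scale_measure[OF f])
qed

lemma nn_integral_Lp_ge:
  assumes "f \<in> borel_measurable sphere_borel"
  shows "ennreal (1 / l) * (\<integral>\<^sup>+v. f v \<partial>spherical_measure) \<le> (\<integral>\<^sup>+v. f v \<partial>Lp_dual_curvature p q K)"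
proof -
  have f: "f \<in> borel_measurable spherical_measure"
    using assms by (simp cong: measurable_cong_sets)
  have eq: "sets (scale_measure (ennreal (1 / l)) spherical_measure) = sets (Lp_dual_curvature p q K)"
    by (simp add: sets_Lp)
  have "scale_measure (ennreal (1 / l)) spherical_measure \<le> Lp_dual_curvature p q K"
    unfolding le_measure_iff using eq sets_eq_imp_space_eq[OF eq]
  proof (simp add: le_fun_def, intro allI)
    fix \<eta> show "ennreal (1 / l) * emeasure spherical_measure \<eta> \<le> emeasure (Lp_dual_curvature p q K) \<eta>"
      using pinched(1)[of \<eta>] by (cases "\<eta> \<in> sets sphere_borel") (simp_all add: emeasure_notin_sets sets_Lp)
  qed
  from nn_integral_mono_measure[OF eq this, of f] show ?thesis
    by (simp add: nn_integral_scale_measure[OF f])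
qed

text \<open>The support function is at least \<open>|a|/2\<close> on the cap of normals within \<open>\<pi>/3\<close> of the direction of
  \<open>a\<close>.\<close>

lemma dual_volume_ge:
  assumes "a \<in> K" 
  shows "ennreal (cap_area TYPE('a) / (l * 2 powr p) * norm a powr p) \<le> dual_volume q"
proof (cases "a = 0")
  case False
  define e where "e = a /\<^sub>R norm a"
  have e: "norm e = 1" "a = norm a *\<^sub>R e" using False by (auto simp: e_def)
  let ?C = "{v \<in> sphere 0 1. 1/2 \<le> v \<bullet> e}"
  have "closed ?C"
    unfolding Collect_conj_eq Collect_mem_eq
    by (intro closed_Int closed_sphere closed_Collect_le continuous_intros)
  then have C: "?C \<in> sets sphere_borel" by (auto simp: sets_sphere_borel)
  have "ennreal (cap_area TYPE('a) / (l * 2 powr p) * norm a powr p)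
      = ennreal (1/l) * (ennreal ((norm a / 2) powr p) * ennreal (cap_area TYPE('a)))"
    using l_pos cap_area_pos[where ?'a='a] by (simp add: ennreal_mult[symmetric] powr_divide mult_ac)
  also have "\<dots> \<le> ennreal (1/l) * (ennreal ((norm a / 2) powr p) * emeasure spherical_measure ?C)"
    by (intro mult_left_mono cap_area_le e) auto
  also have "ennreal ((norm a / 2) powr p) * emeasure spherical_measure ?C
      = (\<integral>\<^sup>+v. ennreal ((norm a / 2) powr p) * indicator ?C v \<partial>spherical_measure)"
    using C by (simp add: nn_integral_cmult_indicator)
  also have "\<dots> \<le> (\<integral>\<^sup>+v. ennreal (h v powr p) \<partial>spherical_measure)"
  proof (rule nn_integral_mono)
    fix v :: 'a
    have "norm a / 2 \<le> h v" if "v \<in> ?C"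
    proof -
      have "norm a / 2 \<le> norm a * (v \<bullet> e)" using that mult_left_mono[of "1/2" "v \<bullet> e" "norm a"] by simp
      also have "\<dots> = v \<bullet> a" by (metis e(2) inner_scaleR_right)
      also have "\<dots> \<le> h v" by (rule support_fun_ge[OF bounded_K assms])
      finally show ?thesis .
    qed
    then show "ennreal ((norm a / 2) powr p) * indicator ?C v \<le> ennreal (h v powr p)"
      using p_pos by (auto simp: indicator_def intro!: ennreal_leI powr_mono2)
  qed
  also have "ennreal (1/l) * (\<integral>\<^sup>+v. ennreal (h v powr p) \<partial>spherical_measure)
      \<le> (\<integral>\<^sup>+v. ennreal (h v powr p) \<partial>Lp_dual_curvature p q K)"
    using measurable_support_fun[OF compact_K nonempty] by (intro nn_integral_Lp_ge) measurable
  also have "\<dots> = dual_volume q"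
    unfolding dual_volume_eq by (subst nn_integral_dual_curvature) auto
  finally show ?thesis by (simp add: mult_left_mono)
qed simp

lemma dual_volume_le_support:
  assumes "\<And>x. x \<in> K \<Longrightarrow> norm x \<le> R" 
  shows "dual_volume q \<le> ennreal (l * sphere_area TYPE('a) * R powr p)"
proof -
  have "dual_volume q = (\<integral>\<^sup>+v. ennreal (h v powr p) \<partial>Lp_dual_curvature p q K)"
    unfolding dual_volume_eq by (subst nn_integral_dual_curvature) auto
  also have "\<dots> \<le> ennreal l * (\<integral>\<^sup>+v. ennreal (h v powr p) \<partial>spherical_measure)"
    using measurable_support_fun[OF compact_K nonempty] by (intro nn_integral_Lp_le) measurable
  also have "\<dots> \<le> ennreal l * (\<integral>\<^sup>+v. ennreal (R powr p) \<partial>(spherical_measure :: 'a measure))"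
  proof (intro mult_left_mono nn_integral_mono ennreal_leI)
    fix v :: 'a assume "v \<in> space spherical_measure"
    then have v: "norm v = 1" by simp
    have "h v \<le> R" using support_fun_norm_le[OF compact_K nonempty assms, of v] v by simp
    moreover have "0 < h v" using v by (intro support_pos) auto
    ultimately show "h v powr p \<le> R powr p" using p_pos by (intro powr_mono2) auto
  qed simp
  also have "\<dots> = ennreal (l * sphere_area TYPE('a) * R powr p)"
    using l_pos sphere_area_pos[where ?'a='a] by (simp add: emeasure_sphere ennreal_mult[symmetric] mult_ac)
  finally show ?thesis .
qed

lemma dual_volume_finite: "dual_volume q < \<infinity>"
proof -
  obtain R where "\<And>x. x \<in> K \<Longrightarrow> norm x \<le> R" using bounded_K by (auto simp: bounded_iff)
  from dual_volume_le_support[OF this] show ?thesis by (simp add: le_less_trans)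
qed

text \<open>The first variation in the direction of \<open>Q\<close>, restricted to a closed set \<open>E\<close> of normals that
  accounts for \<open>A\<close>. The factor \<open>h\<^sup>p\<^sup>-\<^sup>1\<close> is \<open>h\<^sup>-\<^sup>1\<close> from the relative growth of the radius, times \<open>h\<^sup>p\<close> from
  the upper curvature bound.\<close>

lemma radial_weight_sum_le:
  assumes Q: "compact Q" "0 \<in> Q" and E: "closed E" "E \<subseteq> sphere 0 1"
    and t: "0 < t" "\<And>v. v \<in> sphere 0 1 \<Longrightarrow> t * support_fun Q v \<le> h v"
    and A: "A \<in> sets borel" "\<And>x. x \<in> A \<Longrightarrow> x \<notin> K" "\<And>x. x \<in> A \<Longrightarrow> \<exists>y\<in>K. \<exists>z\<in>Q. x = y + t *\<^sub>R z"
    and AE: "\<And>r u v. u \<in> sphere 0 1 \<Longrightarrow> v \<in> sphere 0 1 \<Longrightarrow> 0 < r \<Longrightarrow> r *\<^sub>R u \<in> A \<Longrightarrow> normal_at u v \<Longrightarrow>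
      r \<le> 2 * radial_fun K u \<Longrightarrow> v \<in> E"
  shows "emeasure (radial_weight q) A \<le> ennreal (2 powr q * t * l) *
    (\<integral>\<^sup>+v\<in>E. ennreal (support_fun Q v * h v powr (p - 1)) \<partial>spherical_measure)"
proof -
  have Qb: "bounded Q" "Q \<noteq> {}" using Q by (auto intro: compact_imp_bounded)
  define g where "g v = (if v \<in> E then support_fun Q v / h v else 0)" for v
  have hpos: "0 < h v" if "v \<in> sphere 0 1" for v
    using that by (intro support_pos) auto
  have sQ: "0 \<le> support_fun Q v" for v using Qb(1) Q(2) by (rule support_fun_nonneg)
  have Em: "E \<in> sets sphere_borel" using E by (auto simp: sets_sphere_borel)
  have hm: "h \<in> borel_measurable sphere_borel"
    by (rule measurable_support_fun[OF compact_K nonempty])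
  have gm: "g \<in> borel_measurable sphere_borel"
    unfolding g_def
    using hm measurable_support_fun[OF Q(1) Qb(2)] Em
    by (intro measurable_If_set borel_measurable_divide) (simp_all add: space_restrict_space Int_absorb2[OF E(2)])
  have "emeasure (radial_weight q) A \<le> ennreal (2 powr q * t) * (\<integral>\<^sup>+v. ennreal (g v) \<partial>dual_curvature q K)"
  proof (rule first_variation[OF q_ge sets_dual_curvature emeasure_dual_curvature_closed, where B="1/t"])
    fix v assume v: "v \<in> sphere (0::'a) 1"
    show "0 \<le> g v" using sQ hpos[OF v] by (simp add: g_def less_imp_le)
    show "g v \<le> 1 / t" using t(2)[OF v] hpos[OF v] t(1) by (simp add: g_def field_simps)
  next
    fix c :: real assume c: "0 < c"
    have "{v \<in> sphere 0 1. c \<le> g v} = E \<inter> {v. c * h v \<le> support_fun Q v}"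
      using c E hpos by (auto simp: g_def pos_le_divide_eq subset_iff)
    also have "closed \<dots>"
      by (intro closed_Int E closed_Collect_le continuous_intros continuous_on_support_fun compact_K nonempty Q Qb)
    finally show "closed {v \<in> sphere 0 1. c \<le> g v}" .
  next
    fix r u assume u: "u \<in> sphere (0::'a) 1" and r: "0 < r" "r *\<^sub>R u \<in> A"
    then have un: "u \<noteq> 0" by auto
    obtain v where v: "v \<in> sphere 0 1" "normal_at u v" by (rule ex_normal[OF u])
    obtain y z where yz: "y \<in> K" "z \<in> Q" "r *\<^sub>R u = y + t *\<^sub>R z" using A(3)[OF r(2)] by blast
    have le: "r \<le> radial_fun K u * (1 + t * (support_fun Q v / h v))"
      using radius_of_sum_le[OF u v Qb(1) yz(3,1,2)] t by simp
    have "t * (support_fun Q v / h v) \<le> 1" using t(2)[OF v(1)] hpos[OF v(1)] by simp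
    then have "radial_fun K u * (1 + t * (support_fun Q v / h v)) \<le> radial_fun K u * 2"
      using radial_pos[OF un] by (intro mult_left_mono) auto
    then have "v \<in> E" using le by (intro AE[OF u v(1) r v(2)]) linarith
    moreover have "radial_fun K u \<le> r"
      using mem_iff_le_radial[OF un, of r] A(2)[OF r(2)] r(1) by linarith
    ultimately show "\<exists>v\<in>sphere 0 1. normal_at u v \<and> radial_fun K u \<le> r \<and> r \<le> radial_fun K u * (1 + t * g v)"
      using v le by (auto simp: g_def)
  qed (use t A dual_volume_finite in auto)
  also have "(\<integral>\<^sup>+v. ennreal (g v) \<partial>dual_curvature q K)
      = (\<integral>\<^sup>+v. ennreal (g v) * ennreal (h v powr p) \<partial>Lp_dual_curvature p q K)"
    by (intro nn_integral_dual_curvature measurable_compose[OF gm]) simp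
  also have "\<dots> \<le> ennreal l * (\<integral>\<^sup>+v. ennreal (g v) * ennreal (h v powr p) \<partial>spherical_measure)"
    by (intro nn_integral_Lp_le borel_measurable_times_ennreal measurable_compose[OF gm]
        measurable_compose[OF hm]) simp_all
  also have "(\<integral>\<^sup>+v. ennreal (g v) * ennreal (h v powr p) \<partial>spherical_measure)
      = (\<integral>\<^sup>+v\<in>E. ennreal (support_fun Q v * h v powr (p - 1)) \<partial>spherical_measure)"
  proof (rule nn_integral_cong)
    fix v :: 'a assume "v \<in> space spherical_measure"
    then have "0 < h v" using hpos by simp
    then show "ennreal (g v) * ennreal (h v powr p)
        = ennreal (support_fun Q v * h v powr (p - 1)) * indicator E v"
      using sQ[of v] by (auto simp: g_def ennreal_mult[symmetric] powr_diff)
  qed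
  finally show ?thesis
    using t l_pos by (simp add: ennreal_mult mult.assoc mult_left_mono)
qed

end

section \<open>Mass near the origin and mass far from it\<close>

lemma emeasure_radial_weight_scale:
  fixes X :: "'a::euclidean_space set"
  assumes c: "0 < c" and X: "closed X"
  shows "emeasure (radial_weight q) ((*\<^sub>R) c ` X) = ennreal (c powr q) * emeasure (radial_weight q) X"
proof -
  have [measurable]: "X \<in> sets borel" "(*\<^sub>R) c ` X \<in> sets borel"
    using X closed_scaling[OF X, of c] by auto
  have "emeasure (radial_weight q) ((*\<^sub>R) c ` X)
      = (\<integral>\<^sup>+x. ennreal (norm x powr (q - DIM('a))) * indicator ((*\<^sub>R) c ` X) x \<partial>lborel)"
    by (rule emeasure_radial_weight) measurable
  also have "\<dots> = ennreal (\<bar>c\<bar> ^ DIM('a)) * (\<integral>\<^sup>+x. ennreal (norm (0 + c *\<^sub>R x) powr (q - DIM('a))) *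
      indicator ((*\<^sub>R) c ` X) (0 + c *\<^sub>R x) \<partial>lborel)"
    using c by (intro nn_integral_lborel_affine) auto
  also have "\<dots> = ennreal (c ^ DIM('a)) * (\<integral>\<^sup>+x. ennreal (c powr (q - DIM('a))) *
      (ennreal (norm x powr (q - DIM('a))) * indicator X x) \<partial>lborel)"
  proof -
    have "(ennreal (norm (0 + c *\<^sub>R x) powr (q - DIM('a))) * indicator ((*\<^sub>R) c ` X) (0 + c *\<^sub>R x) :: ennreal)
        = ennreal (c powr (q - DIM('a))) * (ennreal (norm x powr (q - DIM('a))) * indicator X x)" for x
    proof -
      have "c *\<^sub>R x \<in> (*\<^sub>R) c ` X \<longleftrightarrow> x \<in> X" using c by auto
      then show ?thesis using c by (simp add: powr_mult indicator_def ennreal_mult)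
    qed
    then show ?thesis using c by simp
  qed
  also have "\<dots> = ennreal (c ^ DIM('a)) * (ennreal (c powr (q - DIM('a))) * emeasure (radial_weight q) X)"
    by (subst nn_integral_cmult) (auto simp: emeasure_radial_weight)
  also have "\<dots> = ennreal (c ^ DIM('a) * c powr (q - DIM('a))) * emeasure (radial_weight q) X"
    using c by (simp add: ennreal_mult mult.assoc)
  also have "c ^ DIM('a) * c powr (q - DIM('a)) = c powr q"
    using c by (simp add: powr_realpow[symmetric] powr_add[symmetric])
  finally show ?thesis .
qed

text \<open>Away from the origin the weight \<open>|x|\<^sup>q\<^sup>-\<^sup>n\<close> changes at most by a constant factor under a
  short translation.\<close>

lemma emeasure_radial_weight_translate_le:
  fixes A :: "'a::euclidean_space set" and q s :: real
  assumes q: "0 \<le> q" "q \<le> DIM('a)" and A: "A \<in> sets borel" and b: "norm b \<le> s / 2" "0 < s"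
  shows "emeasure (radial_weight q) {x. s < norm x \<and> x + b \<in> A}
    \<le> ennreal (2 ^ DIM('a)) * emeasure (radial_weight q) A"
proof -
  have [measurable]: "A \<in> sets borel" by fact
  have "emeasure (radial_weight q) {x. s < norm x \<and> x + b \<in> A}
      = (\<integral>\<^sup>+x. ennreal (norm x powr (q - DIM('a))) * indicator {x. s < norm x \<and> x + b \<in> A} x \<partial>lborel)"
    by (rule emeasure_radial_weight) measurable
  also have "\<dots> \<le> (\<integral>\<^sup>+x. ennreal (2 ^ DIM('a)) * (ennreal (norm (b + 1 *\<^sub>R x) powr (q - DIM('a))) *
      indicator A (b + 1 *\<^sub>R x)) \<partial>lborel)"
  proof (rule nn_integral_mono)
    fix x :: 'a
    have "norm x powr (q - DIM('a)) \<le> 2 ^ DIM('a) * norm (b + x) powr (q - DIM('a))" if x: "s < norm x"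
    proof -
      have "norm (b + x) \<le> norm b + norm x" "norm x \<le> norm (b + x) + norm b"
        using norm_triangle_ineq[of b x] norm_triangle_ineq4[of "b + x" b] by simp_all
      then have y: "0 < norm (b + x)" "norm (b + x) / 2 \<le> norm x" using b x by linarith+
      have "norm x powr (q - DIM('a)) \<le> (norm (b + x) / 2) powr (q - DIM('a))"
        using y q by (intro powr_mono2') auto
      also have "\<dots> = 2 powr (DIM('a) - q) * norm (b + x) powr (q - DIM('a))"
        using y powr_minus_divide[of 2 "DIM('a) - q"] by (simp add: powr_divide field_simps)
      also have "2 powr (DIM('a) - q) \<le> 2 powr DIM('a)" using q by (intro powr_mono) auto
      finally show ?thesis by (simp add: powr_realpow mult_right_mono)
    qed
    then show "ennreal (norm x powr (q - DIM('a))) * indicator {x. s < norm x \<and> x + b \<in> A} x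
        \<le> ennreal (2 ^ DIM('a)) * (ennreal (norm (b + 1 *\<^sub>R x) powr (q - DIM('a))) * indicator A (b + 1 *\<^sub>R x))"
      by (auto simp: indicator_def ennreal_mult[symmetric] add.commute intro!: ennreal_leI)
  qed
  also have "\<dots> = ennreal (2 ^ DIM('a)) * (\<integral>\<^sup>+x. ennreal (norm (b + 1 *\<^sub>R x) powr (q - DIM('a))) *
      indicator A (b + 1 *\<^sub>R x) \<partial>lborel)"
    by (rule nn_integral_cmult) measurable
  also have "(\<integral>\<^sup>+x. ennreal (norm (b + 1 *\<^sub>R x) powr (q - DIM('a))) * indicator A (b + 1 *\<^sub>R x) \<partial>lborel)
      = emeasure (radial_weight q) A"
    using nn_integral_lborel_affine[of 1 "\<lambda>x. ennreal (norm x powr (q - DIM('a))) * indicator A x" b]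
    by (simp add: emeasure_radial_weight[OF A])
  finally show ?thesis .
qed

context pinched_curvature
begin

lemma radial_weight_finite: "emeasure (radial_weight q) K < \<infinity>"
  using radial_weight_le_dual_volume[OF q_ge] dual_volume_finite by (rule le_less_trans)

text \<open>Doubling the part \<open>Q\<close> of \<open>K\<close> near the origin multiplies its weight by \<open>2\<^sup>q\<close>, hence at least by 2;
  what leaves \<open>K\<close> lies in \<open>K + Q\<close> and is controlled by the first variation in the direction of \<open>Q\<close>.
  Since \<open>h\<^sub>Q\<close> is at most \<open>h\<close>, the integrand \<open>h\<^sub>Q h\<^sup>p\<^sup>-\<^sup>1\<close> is at most \<open>h\<^sub>Q\<^sup>p\<close> for \<open>p \<le> 1\<close>, and this is small
  compared with \<open>R\<^sup>p\<close>.\<close>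

lemma radial_weight_le_far_part:
  assumes R: "\<And>x. x \<in> K \<Longrightarrow> norm x \<le> R" "0 < R" and \<delta>: "0 < \<delta>" "\<delta> \<le> 1"
  shows "emeasure (radial_weight q) K \<le> 2 * emeasure (radial_weight q) (K - cball 0 (\<delta> * R))
    + ennreal (2 powr q * l * sphere_area TYPE('a) * (\<delta> powr min p 1 * R powr p))"
proof -
  let ?\<mu> = "radial_weight q :: 'a measure"
  let ?Q = "K \<inter> cball 0 (\<delta> * R)"
  let ?C = "\<delta> powr min p 1 * R powr p"
  have Q: "compact ?Q" "0 \<in> ?Q" "?Q \<noteq> {}" using compact_K zero_mem \<delta> R by (auto intro: compact_Int)
  define A where "A = {y + z |y z. y \<in> K \<and> z \<in> ?Q} - K"
  have A: "A \<in> sets borel"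
    unfolding A_def using compact_imp_closed[OF compact_sums[OF compact_K Q(1)]] closed_K by auto
  have "emeasure ?\<mu> A \<le> ennreal (2 powr q * 1 * l) *
      (\<integral>\<^sup>+v\<in>sphere 0 1. ennreal (support_fun ?Q v * h v powr (p - 1)) \<partial>spherical_measure)"
  proof (rule radial_weight_sum_le[OF Q(1,2)])
    show "1 * support_fun ?Q v \<le> h v" for v
      using support_fun_mono[OF bounded_K _ Q(3), of v] by simp
    show "\<exists>y\<in>K. \<exists>z\<in>?Q. x = y + 1 *\<^sub>R z" if xA: "x \<in> A" for x
    proof -
      obtain y z where "y \<in> K" "z \<in> ?Q" "x = y + z" using xA unfolding A_def by blast
      then show ?thesis by (intro bexI[of _ y] bexI[of _ z]) simp_all
    qed
  qed (use A in \<open>auto simp: A_def\<close>)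
  also have "(\<integral>\<^sup>+v\<in>sphere 0 1. ennreal (support_fun ?Q v * h v powr (p - 1)) \<partial>spherical_measure)
      \<le> (\<integral>\<^sup>+v. ennreal ?C \<partial>(spherical_measure :: 'a measure))"
  proof (rule nn_integral_mono)
    fix v :: 'a assume "v \<in> space spherical_measure"
    then have v: "norm v = 1" by simp
    have h: "0 < h v" using v by (intro support_pos) auto
    have hQ: "0 \<le> support_fun ?Q v" "support_fun ?Q v \<le> h v" "support_fun ?Q v \<le> \<delta> * R"
      using support_fun_nonneg[of ?Q v] support_fun_mono[OF bounded_K _ Q(3), of v]
        support_fun_norm_le[OF Q(1,3), of "\<delta> * R" v] bounded_K Q v by (auto simp: compact_imp_bounded)
    have hR: "h v \<le> R" using support_fun_norm_le[OF compact_K nonempty R(1), of v] v by simp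
    have "support_fun ?Q v * h v powr (p - 1) \<le> ?C"
    proof (cases "p \<le> 1")
      case True
      show ?thesis
      proof (cases "support_fun ?Q v = 0")
        case False
        then have pos: "0 < support_fun ?Q v" using hQ by simp
        have "support_fun ?Q v * h v powr (p - 1) \<le> support_fun ?Q v * support_fun ?Q v powr (p - 1)"
          using True hQ pos by (intro mult_left_mono powr_mono2') auto
        also have "\<dots> = support_fun ?Q v powr p" using pos by (simp add: powr_mult_base)
        also have "\<dots> \<le> (\<delta> * R) powr p" using hQ p_pos by (intro powr_mono2) auto
        also have "\<dots> = ?C" using True \<delta> R by (simp add: powr_mult)
        finally show ?thesis .
      qed simp
    next
      case False
      have "support_fun ?Q v * h v powr (p - 1) \<le> (\<delta> * R) * R powr (p - 1)"
        using False hQ h hR \<delta> R by (intro mult_mono powr_mono2) auto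
      also have "\<dots> = ?C" using False \<delta> R by (simp add: mult.assoc powr_mult_base)
      finally show ?thesis .
    qed
    then show "ennreal (support_fun ?Q v * h v powr (p - 1)) * indicator (sphere 0 1) v \<le> ennreal ?C"
      using v by (auto intro: ennreal_leI)
  qed
  also have "\<dots> = ennreal (?C * sphere_area TYPE('a))"
    using sphere_area_pos[where ?'a='a] by (simp add: emeasure_sphere ennreal_mult[symmetric])
  finally have EA: "emeasure ?\<mu> A \<le> ennreal (2 powr q * l * sphere_area TYPE('a) * ?C)"
    using l_pos sphere_area_pos[where ?'a='a] by (simp add: ennreal_mult[symmetric] mult_right_mono mult_ac)
  define N F where "N = emeasure ?\<mu> ?Q" and "F = emeasure ?\<mu> (K - cball 0 (\<delta> * R))"
  have KNF: "emeasure ?\<mu> K = N + F"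
    unfolding N_def F_def using closed_K
    by (subst plus_emeasure) (auto intro!: arg_cong[where f="emeasure ?\<mu>"])
  have "2 * N \<le> ennreal (2 powr q) * N"
    using powr_mono[of 1 q "2::real"] q_ge by (intro mult_right_mono) (auto simp: ennreal_numeral[symmetric] simp del: ennreal_numeral)
  also have "\<dots> = emeasure ?\<mu> ((*\<^sub>R) 2 ` ?Q)"
    unfolding N_def using closed_K by (intro emeasure_radial_weight_scale[symmetric]) auto
  also have "\<dots> \<le> emeasure ?\<mu> (K \<union> A)"
  proof (rule emeasure_mono)
    show "(*\<^sub>R) 2 ` ?Q \<subseteq> K \<union> A"
    proof
      fix x assume "x \<in> (*\<^sub>R) 2 ` ?Q"
      then obtain y where "y \<in> ?Q" "x = y + y" by (auto simp: scaleR_2)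
      then show "x \<in> K \<union> A" by (auto simp: A_def)
    qed
  qed (use A closed_K in auto)
  also have "\<dots> \<le> emeasure ?\<mu> K + emeasure ?\<mu> A"
    using A closed_K by (intro emeasure_subadditive) auto
  finally have "N + N \<le> N + (F + emeasure ?\<mu> A)" by (simp add: KNF mult_2 add.assoc)
  moreover have "N < \<infinity>" using radial_weight_finite unfolding KNF by auto
  ultimately have "N \<le> F + emeasure ?\<mu> A" by (auto simp: ennreal_add_left_cancel_le)
  then have "emeasure ?\<mu> K \<le> 2 * F + emeasure ?\<mu> A"
    unfolding KNF by (simp add: mult_2 add.commute add.left_commute add_left_mono)
  also have "\<dots> \<le> 2 * F + ennreal (2 powr q * l * sphere_area TYPE('a) * ?C)"
    using EA by (rule add_left_mono)
  finally show ?thesis by (simp add: F_def)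
qed

definition far_normals :: "real \<Rightarrow> 'a set" where
  "far_normals G = {v \<in> sphere 0 1. \<exists>x\<in>K. v \<bullet> x = h v \<and> G \<le> norm x}"

lemma closed_touching_normals:
  assumes "closed X" shows "closed {v \<in> sphere 0 1. \<exists>x\<in>K. v \<bullet> x = h v \<and> x \<in> X}"
proof -
  let ?Z = "(sphere 0 1 \<times> (K \<inter> X)) \<inter> {z. fst z \<bullet> snd z = h (fst z)}"
  have "closed {z. fst z \<bullet> snd z = h (fst z)}"
    by (intro closed_Collect_eq continuous_intros
        continuous_on_compose2[OF continuous_on_support_fun[OF compact_K nonempty, of UNIV]]) auto
  then have "compact ?Z"
    by (intro compact_Int_closed compact_Times compact_Int_closed[OF compact_K assms]) auto
  then have "compact (fst ` ?Z)" by (intro compact_continuous_image continuous_intros)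
  moreover have "fst ` ?Z = {v \<in> sphere 0 1. \<exists>x\<in>K. v \<bullet> x = h v \<and> x \<in> X}" by force
  ultimately show ?thesis by (simp add: compact_imp_closed)
qed

lemma closed_far_normals: "closed (far_normals G)"
proof -
  have "closed {x::'a. G \<le> norm x}" by (intro closed_Collect_le continuous_intros)
  from closed_touching_normals[OF this] show ?thesis by (simp add: far_normals_def)
qed

text \<open>If \<open>K\<close> lies in the slab \<open>|x \<bullet> w| \<le> W\<close>, then \<open>J\<close> steps of length \<open>t = 3 W / J\<close> in the direction \<open>w\<close>
  lead out of \<open>K\<close>, and the first point outside lies in the thin layer \<open>K + tB - K\<close>. So \<open>J\<close> translates
  of the layer cover the far part of \<open>K\<close>; the layer has weight \<open>O(t)\<close> by the first variation, and
  the number of translates cancels \<open>t\<close> up to \<open>W\<close>.\<close>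

lemma far_part_le:
  assumes w: "norm w = 1" "\<And>x. x \<in> K \<Longrightarrow> \<bar>x \<bullet> w\<bar> \<le> W" and W: "0 < W" "6 * W \<le> s"
  shows "emeasure (radial_weight q) (K - cball 0 s) \<le> ennreal (3 * 2 ^ DIM('a) * 2 powr q * l * W) *
    (\<integral>\<^sup>+v\<in>far_normals (s / 4). ennreal (h v powr (p - 1)) \<partial>spherical_measure)"
proof -
  let ?\<mu> = "radial_weight q :: 'a measure"
  let ?B = "cball (0::'a) 1"
  let ?I = "\<integral>\<^sup>+v\<in>far_normals (s / 4). ennreal (h v powr (p - 1)) \<partial>spherical_measure"
  have s: "0 < s" using W by linarith
  obtain r where r: "0 < r" "cball 0 r \<subseteq> K" by (rule inball)
  \<comment> \<open>\<open>J\<close> is so large that \<open>t\<close> is below the inradius, as the first variation requires.\<close>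
  obtain J :: nat where J: "3 * W < real J * r" using ex_less_of_nat_mult[OF r(1)] by blast
  have J1: "1 \<le> real J" using J W by (cases J) auto
  define t where "t = 3 * W / real J"
  have t: "0 < t" "t \<le> r" "real J * t = 3 * W"
    using J J1 W by (simp_all add: t_def field_simps)
  define A where "A = ({y + z |y z. y \<in> K \<and> z \<in> (*\<^sub>R) t ` ?B} - K) - ball 0 (s / 2)"
  have A: "A \<in> sets borel"
    unfolding A_def
    using compact_imp_closed[OF compact_sums[OF compact_K compact_scaling[OF compact_cball, of t 0 1]]] closed_K
    by auto
  have hB: "support_fun ?B v \<le> 1" if "norm v = 1" for v
    using support_fun_norm_le[of ?B 1 v] that by simp
  have hr: "r \<le> h v" if "norm v = 1" for v
  proof -
    have "r *\<^sub>R v \<in> K" using that r by (intro subsetD[OF r(2)]) simp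
    from support_fun_ge[OF bounded_K this, of v] show ?thesis
      using that by (simp add: dot_square_norm)
  qed
  have "emeasure ?\<mu> A \<le> ennreal (2 powr q * t * l) *
      (\<integral>\<^sup>+v\<in>far_normals (s / 4). ennreal (support_fun ?B v * h v powr (p - 1)) \<partial>spherical_measure)"
  proof (rule radial_weight_sum_le)
    show "t * support_fun ?B v \<le> h v" if "v \<in> sphere 0 1" for v
    proof -
      have v: "norm v = 1" using that by simp
      have "t * support_fun ?B v \<le> t * 1" using t(1) hB[OF v] by (intro mult_left_mono) auto
      then show ?thesis using hr[OF v] t(2) by linarith
    qed
    show "\<exists>y\<in>K. \<exists>z\<in>?B. x = y + t *\<^sub>R z" if "x \<in> A" for x
      using that by (auto simp: A_def)
    show "far_normals (s / 4) \<subseteq> sphere 0 1" by (auto simp: far_normals_def)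
    show "x \<notin> K" if "x \<in> A" for x using that by (simp add: A_def)
    fix ra u v assume *: "u \<in> sphere (0::'a) 1" "v \<in> sphere (0::'a) 1" "0 < ra" "ra *\<^sub>R u \<in> A"
      "normal_at u v" "ra \<le> 2 * radial_fun K u"
    then have u: "u \<noteq> 0" "norm u = 1" by auto
    have "s / 2 \<le> ra" using * u by (auto simp: A_def)
    then have "s / 4 \<le> norm (radial_fun K u *\<^sub>R u)" using * u radial_pos[OF u(1)] by simp
    moreover have "v \<bullet> (radial_fun K u *\<^sub>R u) = h v"
      using outer_unit_normal_iff[OF *(1,2)] *(5) by blast
    ultimately show "v \<in> far_normals (s / 4)"
      unfolding far_normals_def using *(2) radial_set(1)[OF u(1)] by blast
  qed (use t A closed_far_normals in auto)
  also have "(\<integral>\<^sup>+v\<in>far_normals (s / 4). ennreal (support_fun ?B v * h v powr (p - 1)) \<partial>spherical_measure) \<le> ?I"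
  proof (rule nn_integral_mono)
    fix v :: 'a assume "v \<in> space spherical_measure"
    then have "support_fun ?B v * h v powr (p - 1) \<le> 1 * h v powr (p - 1)"
      using hB[of v] by (intro mult_right_mono) auto
    then show "ennreal (support_fun ?B v * h v powr (p - 1)) * indicator (far_normals (s / 4)) v
        \<le> ennreal (h v powr (p - 1)) * indicator (far_normals (s / 4)) v"
      by (intro mult_right_mono ennreal_leI) auto
  qed
  finally have EA: "emeasure ?\<mu> A \<le> ennreal (2 powr q * t * l) * ?I" by (simp add: mult_left_mono)
  define S where "S j = {x. s < norm x \<and> x + (real j * t) *\<^sub>R w \<in> A}" for j
  have Sm: "S j \<in> sets borel" for j
  proof -
    have [measurable]: "A \<in> sets borel" by (rule A)
    show ?thesis unfolding S_def by measurable
  qed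
  have cover: "K - cball 0 s \<subseteq> (\<Union>j\<in>{1..J}. S j)"
  proof
    fix x assume "x \<in> K - cball 0 s"
    then have x: "x \<in> K" "s < norm x" by auto
    let ?P = "\<lambda>j. x + (real j * t) *\<^sub>R w \<notin> K"
    have PJ: "?P J"
    proof
      assume "x + (real J * t) *\<^sub>R w \<in> K"
      then have "\<bar>(x + (real J * t) *\<^sub>R w) \<bullet> w\<bar> \<le> W" by (rule w(2))
      then have "x \<bullet> w + 3 * W \<le> W" using w(1) t(3) by (simp add: inner_add_left dot_square_norm)
      then show False using w(2)[OF x(1)] W by linarith
    qed
    define j where "j = (LEAST j. ?P j)"
    have Pj: "?P j" unfolding j_def by (rule LeastI[of ?P, OF PJ])
    have jJ: "j \<le> J" unfolding j_def by (rule Least_le[of ?P, OF PJ])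
    have j0: "j \<noteq> 0" using Pj x by (cases "j = 0") auto
    then have prev: "x + (real (j - 1) * t) *\<^sub>R w \<in> K"
      using not_less_Least[of "j - 1" ?P] unfolding j_def[symmetric] by simp
    have "real j * t = real (j - 1) * t + t" using j0 by (cases j) (simp_all add: algebra_simps)
    then have "x + (real j * t) *\<^sub>R w = (x + (real (j - 1) * t) *\<^sub>R w) + t *\<^sub>R w" by (simp add: scaleR_add_left)
    moreover have "t *\<^sub>R w \<in> (*\<^sub>R) t ` ?B" using w(1) by (intro imageI) simp
    ultimately have "x + (real j * t) *\<^sub>R w \<in> {y + z |y z. y \<in> K \<and> z \<in> (*\<^sub>R) t ` ?B}"
      using prev unfolding mem_Collect_eq by blast
    moreover have "s / 2 \<le> norm (x + (real j * t) *\<^sub>R w)"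
    proof -
      have "real j * t \<le> s / 2"
        using mult_right_mono[of "real j" "real J" t] jJ t W by linarith
      moreover have "norm x \<le> norm (x + (real j * t) *\<^sub>R w) + norm ((real j * t) *\<^sub>R w)"
        using norm_triangle_ineq4[of "x + (real j * t) *\<^sub>R w" "(real j * t) *\<^sub>R w"] by simp
      ultimately show ?thesis using w(1) x t by simp
    qed
    ultimately have "x \<in> S j" using Pj x by (auto simp: S_def A_def)
    then show "x \<in> (\<Union>j\<in>{1..J}. S j)" using j0 jJ by (intro UN_I[of j]) auto
  qed
  have "emeasure ?\<mu> (K - cball 0 s) \<le> emeasure ?\<mu> (\<Union>j\<in>{1..J}. S j)"
    using cover Sm by (intro emeasure_mono) auto
  also have "\<dots> \<le> (\<Sum>j\<in>{1..J}. emeasure ?\<mu> (S j))"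
    using Sm by (intro emeasure_subadditive_finite) auto
  also have "\<dots> \<le> (\<Sum>j\<in>{1..J}. ennreal (2 ^ DIM('a)) * emeasure ?\<mu> A)"
  proof (rule sum_mono)
    fix j assume "j \<in> {1..J}"
    then have "real j * t \<le> s / 2" using mult_right_mono[of "real j" "real J" t] t W by auto
    then show "emeasure ?\<mu> (S j) \<le> ennreal (2 ^ DIM('a)) * emeasure ?\<mu> A"
      unfolding S_def using q_ge q_le w t s A by (intro emeasure_radial_weight_translate_le) auto
  qed
  also have "\<dots> = ennreal (real J * 2 ^ DIM('a)) * emeasure ?\<mu> A"
    by (simp add: ennreal_mult ennreal_of_nat_eq_real_of_nat[symmetric] mult.assoc)
  also have "\<dots> \<le> ennreal (real J * 2 ^ DIM('a)) * (ennreal (2 powr q * t * l) * ?I)"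
    by (intro mult_left_mono EA) auto
  also have "\<dots> = ennreal (real J * 2 ^ DIM('a) * (2 powr q * t * l)) * ?I"
    using t l_pos by (simp add: ennreal_mult mult.assoc)
  also have "real J * 2 ^ DIM('a) * (2 powr q * t * l) = 3 * 2 ^ DIM('a) * 2 powr q * l * W"
    using arg_cong[OF t(3), of "\<lambda>x. x * 2 ^ DIM('a) * 2 powr q * l"] by (simp add: mult_ac)
  finally show ?thesis .
qed

end

section \<open>Normals with far contact points\<close>

text \<open>The second summand is the sum of the geometric series in \<open>steep_integral_le\<close>.\<close>

definition steep_const :: "'a::euclidean_space itself \<Rightarrow> real \<Rightarrow> real" where
  "steep_const _ p = sphere_area TYPE('a) +
     2 * real DIM('a) * measure lborel (cball (0::'a) 2) * 2 powr (1 - p) / (1 - 2 powr (- p))"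

definition far_const :: "'a::euclidean_space itself \<Rightarrow> real \<Rightarrow> real \<Rightarrow> real" where
  "far_const _ p \<kappa> = (if 1 \<le> p then sphere_area TYPE('a)
     else 2 * real DIM('a) * steep_const TYPE('a) p * (\<kappa> / real DIM('a)) powr (p - 1))"

lemma steep_const_pos: "0 < p \<Longrightarrow> 0 < steep_const TYPE('a::euclidean_space) p"
proof -
  assume "0 < p"
  then have "(2::real) powr (- p) < 1" using powr_less_mono[of "- p" 0 "2::real"] by simp
  then show ?thesis using sphere_area_pos[where ?'a='a] by (simp add: steep_const_def add_pos_nonneg)
qed

lemma far_const_pos: "0 < p \<Longrightarrow> 0 < \<kappa> \<Longrightarrow> 0 < far_const TYPE('a::euclidean_space) p \<kappa>"
  using sphere_area_pos[where ?'a='a] steep_const_pos[of p, where ?'a='a] by (simp add: far_const_def)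

context body_around_origin
begin

text \<open>The normals at whose contact point the support function has slope at least \<open>G\<close> in the
  direction \<open>a\<close>: the contact point is a subgradient of the support function.\<close>

definition steep_normals :: "'a \<Rightarrow> real \<Rightarrow> 'a set" where
  "steep_normals a G = {v \<in> sphere 0 1. \<exists>x\<in>K. v \<bullet> x = support_fun K v \<and> G \<le> a \<bullet> x}"

end

context pinched_curvature
begin

lemma closed_steep_normals: "closed (steep_normals a G)"
proof -
  have "closed {x. G \<le> a \<bullet> x}" by (intro closed_Collect_le continuous_intros)
  from closed_touching_normals[OF this] show ?thesis by (simp add: steep_normals_def)
qed

lemma steep_normals_borel: "steep_normals a G \<in> sets sphere_borel"
proof -
  have "steep_normals a G \<subseteq> sphere 0 1" by (auto simp: steep_normals_def)
  then show ?thesis using closed_steep_normals by (auto simp: sets_sphere_borel)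
qed

lemma steep_sublevel_borel: "{v \<in> steep_normals a G. h v < s} \<in> sets sphere_borel"
proof -
  have "{v \<in> steep_normals a G. h v < s} = steep_normals a G \<inter> {v. h v < s}" by auto
  moreover have "open {v. h v < s}"
    by (intro open_Collect_less continuous_intros continuous_on_support_fun compact_K nonempty)
  ultimately show ?thesis
    using steep_normals_borel[of a G] by (auto simp: sets_sphere_borel)
qed

text \<open>Along the direction \<open>a\<close> the support function grows with slope at least \<open>G\<close> from every
  normal in \<open>steep_normals a G\<close>. So the cone over the part of this set where \<open>h < s\<close> has about
  \<open>G / s\<close> disjoint translates inside the ball of radius 2.\<close>

lemma steep_sublevel_measure:
  assumes a: "norm a = 1" and s: "0 < s" "s \<le> G"
  shows "emeasure spherical_measure {v \<in> steep_normals a G. h v < s}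
    \<le> ennreal (2 * real DIM('a) * measure lborel (cball (0::'a) 2) * (s / G))"
proof -
  define \<eta> where "\<eta> = {v \<in> steep_normals a G. h v < s}"
  define C where "C = {x. x \<noteq> 0 \<and> norm x \<le> 1 \<and> x /\<^sub>R norm x \<in> \<eta>}"
  have \<eta>: "\<eta> \<in> sets sphere_borel" unfolding \<eta>_def by (rule steep_sublevel_borel)
  have [measurable]: "\<eta> \<in> sets borel" using \<eta> by (simp add: sets_sphere_borel)
  have C [measurable]: "C \<in> sets borel" unfolding C_def by measurable
  define \<tau> where "\<tau> = s / G"
  have \<tau>: "0 < \<tau>" "\<tau> * G = s" "\<tau> \<le> 1" using s by (simp_all add: \<tau>_def)
  define N where "N = nat \<lfloor>G / s\<rfloor>"
  have GN: "1 \<le> G / s" using s by simp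
  have N: "real N \<le> G / s" "G / s \<le> 2 * real N"
  proof -
    have "1 \<le> \<lfloor>G / s\<rfloor>" using GN by simp
    then have "real N = of_int \<lfloor>G / s\<rfloor>" "1 \<le> real N" by (simp_all add: N_def)
    then show "real N \<le> G / s" "G / s \<le> 2 * real N" by linarith+
  qed
  define T where "T k = {x. - ((real k * \<tau>) *\<^sub>R a) + 1 *\<^sub>R x \<in> C}" for k :: nat
  have T: "T k \<in> sets borel" for k unfolding T_def by measurable
  have ET: "emeasure lborel (T k) = emeasure lborel C" for k
    using emeasure_lborel_affine_vimage[of 1 C "- ((real k * \<tau>) *\<^sub>R a)"] C by (simp add: T_def)
  have low: "y \<bullet> x < s" if "y \<in> C" "x \<in> K" for x y
  proof -
    have y: "y \<noteq> 0" "norm y \<le> 1" "y /\<^sub>R norm y \<in> \<eta>" using that by (auto simp: C_def)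
    have "y \<bullet> x = norm y * ((y /\<^sub>R norm y) \<bullet> x)" using y by simp
    also have "\<dots> \<le> norm y * h (y /\<^sub>R norm y)" by (intro mult_left_mono support_fun_ge bounded_K that) simp
    also have "\<dots> \<le> 1 * h (y /\<^sub>R norm y)"
      using y support_fun_nonneg[OF bounded_K zero_mem] by (intro mult_right_mono) auto
    also have "\<dots> < s" using y by (simp add: \<eta>_def)
    finally show ?thesis .
  qed
  have high: "\<exists>x\<in>K. 0 \<le> y \<bullet> x \<and> G \<le> a \<bullet> x" if "y \<in> C" for y
  proof -
    have y: "y \<noteq> 0" "y /\<^sub>R norm y \<in> \<eta>" using that by (auto simp: C_def)
    then obtain x where x: "x \<in> K" "(y /\<^sub>R norm y) \<bullet> x = h (y /\<^sub>R norm y)" "G \<le> a \<bullet> x"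
      by (auto simp: \<eta>_def steep_normals_def)
    have "y \<bullet> x = norm y * ((y /\<^sub>R norm y) \<bullet> x)" using y by simp
    also have "0 \<le> \<dots>" unfolding x(2) using support_fun_nonneg[OF bounded_K zero_mem] by simp
    finally show ?thesis using x by blast
  qed
  \<comment> \<open>Two overlapping translates would give cone points \<open>y\<close>, \<open>y'\<close> with \<open>y - y'\<close> at least \<open>\<tau>\<close> long in
    direction \<open>a\<close>; the contact point \<open>z\<close> of \<open>y'\<close> then forces \<open>y \<bullet> z \<ge> \<tau> G = s\<close>.\<close>
  have disj: False if "x \<in> T i" "x \<in> T j" "i < j" for x i j
  proof -
    define y y' where "y = - ((real i * \<tau>) *\<^sub>R a) + 1 *\<^sub>R x" and "y' = - ((real j * \<tau>) *\<^sub>R a) + 1 *\<^sub>R x"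
    have yC: "y \<in> C" "y' \<in> C" using that by (auto simp: T_def y_def y'_def)
    obtain z where z: "z \<in> K" "0 \<le> y' \<bullet> z" "G \<le> a \<bullet> z" using high[OF yC(2)] by blast
    have "y = y' + ((real j - real i) * \<tau>) *\<^sub>R a" by (simp add: y_def y'_def algebra_simps)
    then have "y \<bullet> z = y' \<bullet> z + (real j - real i) * \<tau> * (a \<bullet> z)" by (simp add: inner_add_left)
    moreover have "1 * \<tau> * G \<le> (real j - real i) * \<tau> * (a \<bullet> z)"
      using \<tau> s z(3) that(3) by (intro mult_mono) auto
    ultimately have "s \<le> y \<bullet> z" using z(2) \<tau> by simp
    then show False using low[OF yC(1) z(1)] by simp
  qed
  have "disjoint_family_on T {..<N}"
    using disj by (fastforce simp: disjoint_family_on_def neq_iff)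
  then have "(\<Sum>k<N. emeasure lborel (T k)) = emeasure lborel (\<Union>k<N. T k)"
    using T by (intro sum_emeasure) auto
  also have "\<dots> \<le> emeasure lborel (cball (0::'a) 2)"
  proof (rule emeasure_mono)
    show "(\<Union>k<N. T k) \<subseteq> cball 0 2"
    proof
      fix x assume "x \<in> (\<Union>k<N. T k)"
      then obtain k where k: "k < N" "x \<in> T k" by auto
      define y where "y = - ((real k * \<tau>) *\<^sub>R a) + 1 *\<^sub>R x"
      have "norm y \<le> 1" using k by (auto simp: T_def C_def y_def)
      moreover have "x = y + (real k * \<tau>) *\<^sub>R a" by (simp add: y_def)
      then have "norm x \<le> norm y + real k * \<tau>" using norm_triangle_ineq[of y "(real k * \<tau>) *\<^sub>R a"] a \<tau> by simp
      moreover have "real k * \<tau> \<le> real N * \<tau>" using k \<tau> by (intro mult_right_mono) auto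
      moreover have "real N * \<tau> \<le> G / s * \<tau>" using N \<tau> by (intro mult_right_mono) auto
      moreover have "G / s * \<tau> = 1" using s by (simp add: \<tau>_def)
      ultimately have "norm x \<le> 2" by linarith
      then show "x \<in> cball 0 2" by simp
    qed
  qed simp
  finally have NC: "of_nat N * emeasure lborel C \<le> emeasure lborel (cball (0::'a) 2)" by (simp add: ET)
  have Cf: "emeasure lborel C < \<infinity>"
  proof -
    have "emeasure lborel C \<le> emeasure lborel (cball (0::'a) 1)"
      by (rule emeasure_mono) (auto simp: C_def)
    then show ?thesis using emeasure_lborel_cball_finite by (rule le_less_trans)
  qed
  define c B where "c = measure lborel C" and "B = measure lborel (cball (0::'a) 2)"
  have cE: "emeasure lborel C = ennreal c" using Cf by (simp add: c_def emeasure_eq_ennreal_measure)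
  have BE: "emeasure lborel (cball (0::'a) 2) = ennreal B"
    using emeasure_lborel_cball_finite[of "0::'a" 2] by (simp add: B_def emeasure_eq_ennreal_measure)
  have c0: "0 \<le> c" "0 \<le> B" by (simp_all add: c_def B_def)
  have "real N * c \<le> B" using NC c0 by (simp add: cE BE ennreal_of_nat_eq_real_of_nat ennreal_mult[symmetric])
  then have "G / s * c \<le> 2 * B" using mult_right_mono[OF N(2) c0(1)] by simp
  then have "c \<le> 2 * B * (s / G)" using s by (simp add: field_simps)
  then have "ennreal (real DIM('a) * c) \<le> ennreal (real DIM('a) * (2 * B * (s / G)))"
    by (intro ennreal_leI mult_left_mono) auto
  moreover have "emeasure spherical_measure \<eta> = ennreal (real DIM('a) * c)"
    unfolding emeasure_spherical_measure[OF \<eta>] C_def[symmetric] cE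
    using c0 by (simp add: ennreal_of_nat_eq_real_of_nat ennreal_mult)
  ultimately show ?thesis by (simp add: \<eta>_def B_def mult_ac)
qed

text \<open>For \<open>p < 1\<close> the integrand blows up where \<open>h\<close> is small, but only as \<open>h\<^sup>p\<^sup>-\<^sup>1\<close>, against sublevel
  sets of measure at most of order \<open>h\<close>; the dyadic levels sum to a geometric series.\<close>

lemma steep_integral_le:
  assumes a: "norm a = 1" and G: "0 < G" and p: "p < 1"
  shows "(\<integral>\<^sup>+v\<in>steep_normals a G. ennreal (h v powr (p - 1)) \<partial>spherical_measure)
    \<le> ennreal (steep_const TYPE('a) p * G powr (p - 1))"
proof -
  define D where "D = 2 * real DIM('a) * measure lborel (cball (0::'a) 2)"
  have D: "0 \<le> D" by (simp add: D_def)
  define L where "L j = {v \<in> steep_normals a G. h v < G / 2 ^ j}" for j :: nat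
  have L: "L j \<in> sets spherical_measure" for j
    using steep_sublevel_borel by (simp add: L_def)
  have Lm: "emeasure spherical_measure (L j) \<le> ennreal (D / 2 ^ j)" for j
    using steep_sublevel_measure[OF a, of "G / 2 ^ j" G] G by (simp add: L_def D_def divide_le_eq mult_le_cancel_left1)
  have "(\<integral>\<^sup>+v\<in>steep_normals a G. ennreal (h v powr (p - 1)) \<partial>spherical_measure)
      \<le> (\<integral>\<^sup>+v. ennreal (G powr (p - 1)) +
          (\<Sum>j. ennreal ((G / 2 ^ Suc j) powr (p - 1)) * indicator (L j) v) \<partial>spherical_measure)"
  proof (rule nn_integral_mono)
    fix v :: 'a assume "v \<in> space spherical_measure"
    then have hv: "0 < h v" by (intro support_pos) auto
    show "ennreal (h v powr (p - 1)) * indicator (steep_normals a G) v \<le> ennreal (G powr (p - 1)) +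
        (\<Sum>j. ennreal ((G / 2 ^ Suc j) powr (p - 1)) * indicator (L j) v)"
    proof (cases "v \<in> steep_normals a G")
      case True
      show ?thesis
      proof (cases "G \<le> h v")
        case True
        then have "h v powr (p - 1) \<le> G powr (p - 1)" using G p by (intro powr_mono2') auto
        then have "ennreal (h v powr (p - 1)) * indicator (steep_normals a G) v \<le> ennreal (G powr (p - 1))"
          by (auto simp: indicator_def intro: ennreal_leI)
        then show ?thesis by (rule order.trans) simp
      next
        case False
        obtain i where "(1/2) ^ i < h v / G" using real_arch_pow_inv[of "h v / G" "1/2"] hv G by auto
        then have i: "G / 2 ^ i \<le> h v" using G by (simp add: field_simps power_divide)
        define k where "k = (LEAST i. G / 2 ^ i \<le> h v)"
        have k: "G / 2 ^ k \<le> h v" unfolding k_def by (rule LeastI[of "\<lambda>i. G / 2 ^ i \<le> h v", OF i])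
        obtain j where j: "k = Suc j" using k False by (cases k) auto
        have "\<not> G / 2 ^ j \<le> h v" using not_less_Least[of j "\<lambda>i. G / 2 ^ i \<le> h v"] j by (simp add: k_def)
        then have vL: "v \<in> L j" using True by (simp add: L_def)
        have "h v powr (p - 1) \<le> (G / 2 ^ Suc j) powr (p - 1)"
          using k G p by (intro powr_mono2') (auto simp: j)
        then have "ennreal (h v powr (p - 1)) * indicator (steep_normals a G) v
            \<le> ennreal ((G / 2 ^ Suc j) powr (p - 1)) * indicator (L j) v"
          using vL True by (simp add: ennreal_leI)
        also have "\<dots> = (\<Sum>j\<in>{j}. ennreal ((G / 2 ^ Suc j) powr (p - 1)) * indicator (L j) v)"
          by (simp only: sum.insert[OF finite.emptyI] empty_iff not_False_eq_True sum.empty add_0_right)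
        also have "\<dots> \<le> (\<Sum>j. ennreal ((G / 2 ^ Suc j) powr (p - 1)) * indicator (L j) v)"
          by (rule sum_le_suminf) auto
        also have "\<dots> \<le> ennreal (G powr (p - 1)) + \<dots>" by simp
        finally show ?thesis .
      qed
    qed simp
  qed
  also have "\<dots> = (\<integral>\<^sup>+v. ennreal (G powr (p - 1)) \<partial>(spherical_measure :: 'a measure)) +
      (\<Sum>j. \<integral>\<^sup>+v. ennreal ((G / 2 ^ Suc j) powr (p - 1)) * indicator (L j) v \<partial>spherical_measure)"
  proof -
    have m: "(\<lambda>v. ennreal ((G / 2 ^ Suc j) powr (p - 1)) * indicator (L j) v) \<in> borel_measurable spherical_measure" for j
      by (intro borel_measurable_times_ennreal borel_measurable_const borel_measurable_indicator L)
    show ?thesis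
      by (subst nn_integral_add[OF borel_measurable_const borel_measurable_suminf_order[OF m]])
         (subst nn_integral_suminf[OF m], rule refl)
  qed
  also have "(\<integral>\<^sup>+v. ennreal (G powr (p - 1)) \<partial>(spherical_measure :: 'a measure))
      = ennreal (G powr (p - 1) * sphere_area TYPE('a))"
    using sphere_area_pos[where ?'a='a] by (simp add: emeasure_sphere ennreal_mult)
  also have "(\<Sum>j. \<integral>\<^sup>+v. ennreal ((G / 2 ^ Suc j) powr (p - 1)) * indicator (L j) v \<partial>spherical_measure)
      \<le> (\<Sum>j. ennreal (G powr (p - 1) * D * 2 powr (1 - p) * (2 powr (- p)) ^ j))"
  proof (intro suminf_le summableI)
    fix j
    have "(\<integral>\<^sup>+v. ennreal ((G / 2 ^ Suc j) powr (p - 1)) * indicator (L j) v \<partial>spherical_measure)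
        = ennreal ((G / 2 ^ Suc j) powr (p - 1)) * emeasure spherical_measure (L j)"
      by (rule nn_integral_cmult_indicator[OF L])
    also have "\<dots> \<le> ennreal ((G / 2 ^ Suc j) powr (p - 1)) * ennreal (D / 2 ^ j)"
      by (intro mult_left_mono Lm) simp
    also have "\<dots> = ennreal ((G / 2 ^ Suc j) powr (p - 1) * (D / 2 ^ j))"
      using D by (intro ennreal_mult[symmetric]) auto
    also have "(G / 2 ^ Suc j) powr (p - 1) * (D / 2 ^ j)
        = G powr (p - 1) * D * 2 powr (1 - p) * (2 powr (- p)) ^ j"
    proof -
      have 1: "(2::real) ^ Suc j = 2 powr (real j + 1)" "(2::real) ^ j = 2 powr real j"
        "(2 powr (- p)) ^ j = 2 powr (- p * real j)"
        by (simp_all add: powr_realpow[symmetric] powr_add powr_powr)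
      have "(G / 2 ^ Suc j) powr (p - 1) = G powr (p - 1) * 2 powr (- ((real j + 1) * (p - 1)))"
        unfolding 1 using G by (simp add: powr_divide powr_powr powr_minus_divide)
      moreover have "2 powr (- ((real j + 1) * (p - 1))) / 2 powr real j
          = 2 powr (1 - p) * (2::real) powr (- p * real j)"
        by (simp add: powr_diff[symmetric] powr_add[symmetric] algebra_simps)
      ultimately show ?thesis unfolding 1 by (simp add: field_simps)
    qed
    finally show "(\<integral>\<^sup>+v. ennreal ((G / 2 ^ Suc j) powr (p - 1)) * indicator (L j) v \<partial>spherical_measure)
        \<le> ennreal (G powr (p - 1) * D * 2 powr (1 - p) * (2 powr (- p)) ^ j)" .
  qed
  also have "(\<Sum>j. ennreal (G powr (p - 1) * D * 2 powr (1 - p) * (2 powr (- p)) ^ j))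
      = ennreal (G powr (p - 1) * D * 2 powr (1 - p) * (1 / (1 - 2 powr (- p))))"
  proof (rule suminf_ennreal_eq)
    have "(2::real) powr (- p) < 1" using p_pos powr_less_mono[of "- p" 0 "2::real"] by simp
    then have "(\<lambda>j. (2 powr (- p)) ^ j) sums (1 / (1 - 2 powr (- p)) :: real)"
      by (intro geometric_sums) simp
    then show "(\<lambda>j. G powr (p - 1) * D * 2 powr (1 - p) * (2 powr (- p)) ^ j)
        sums (G powr (p - 1) * D * 2 powr (1 - p) * (1 / (1 - 2 powr (- p))))"
      by (rule sums_mult)
  qed (use D in simp)
  also have "ennreal (G powr (p - 1) * sphere_area TYPE('a)) +
      ennreal (G powr (p - 1) * D * 2 powr (1 - p) * (1 / (1 - 2 powr (- p))))
      = ennreal (steep_const TYPE('a) p * G powr (p - 1))"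
  proof -
    have "(2::real) powr (- p) < 1" using p_pos powr_less_mono[of "- p" 0 "2::real"] by simp
    then show ?thesis
      using D sphere_area_pos[where ?'a='a]
      by (subst ennreal_plus[symmetric]) (auto simp: steep_const_def D_def algebra_simps add_divide_distrib)
  qed
  finally show ?thesis by (simp add: add_left_mono)
qed

text \<open>For \<open>p \<ge> 1\<close> the integrand is bounded. Otherwise a contact point far from the origin has a
  large coordinate, so that its normals are steep in one of the \<open>2n\<close> signed coordinate directions.\<close>

lemma far_integral_le:
  assumes R: "\<And>x. x \<in> K \<Longrightarrow> norm x \<le> R" "0 < R" and \<kappa>: "0 < \<kappa>"
  shows "(\<integral>\<^sup>+v\<in>far_normals (\<kappa> * R). ennreal (h v powr (p - 1)) \<partial>spherical_measure)
    \<le> ennreal (far_const TYPE('a) p \<kappa> * R powr (p - 1))"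
proof (cases "1 \<le> p")
  case True
  have "(\<integral>\<^sup>+v\<in>far_normals (\<kappa> * R). ennreal (h v powr (p - 1)) \<partial>spherical_measure)
      \<le> (\<integral>\<^sup>+v. ennreal (R powr (p - 1)) \<partial>(spherical_measure :: 'a measure))"
  proof (rule nn_integral_mono)
    fix v :: 'a assume "v \<in> space spherical_measure"
    then have v: "norm v = 1" by simp
    have "h v \<le> R" using support_fun_norm_le[OF compact_K nonempty R(1), of v] v by simp
    then have "h v powr (p - 1) \<le> R powr (p - 1)"
      using True support_fun_nonneg[OF bounded_K zero_mem] by (intro powr_mono2) auto
    then show "ennreal (h v powr (p - 1)) * indicator (far_normals (\<kappa> * R)) v \<le> ennreal (R powr (p - 1))"
      by (auto simp: indicator_def intro: ennreal_leI)
  qed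
  then show ?thesis
    using True sphere_area_pos[where ?'a='a]
    by (simp add: far_const_def emeasure_sphere ennreal_mult[symmetric] mult.commute)
next
  case False
  let ?n = "real DIM('a)"
  define G where "G = \<kappa> * R / ?n"
  have G: "0 < G" using \<kappa> R by (simp add: G_def)
  define I where "I a = (\<integral>\<^sup>+v\<in>steep_normals a G. ennreal (h v powr (p - 1)) \<partial>spherical_measure)" for a :: 'a
  have I: "I a \<le> ennreal (steep_const TYPE('a) p * G powr (p - 1))" if "norm a = 1" for a
    unfolding I_def using False by (intro steep_integral_le that G) simp
  have Im: "(\<lambda>v. ennreal (h v powr (p - 1)) * indicator (steep_normals a G) v) \<in> borel_measurable spherical_measure" for a
  proof -
    have "(\<lambda>v. ennreal (h v powr (p - 1))) \<in> borel_measurable (sphere_borel :: 'a measure)"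
      using measurable_support_fun[OF compact_K nonempty] by measurable
    then have "(\<lambda>v. ennreal (h v powr (p - 1))) \<in> borel_measurable (spherical_measure :: 'a measure)"
      by (simp cong: measurable_cong_sets)
    moreover have "steep_normals a G \<in> sets spherical_measure"
      using steep_normals_borel by simp
    ultimately show ?thesis by (intro borel_measurable_times_ennreal borel_measurable_indicator)
  qed
  have cov: "\<exists>b\<in>Basis. v \<in> steep_normals b G \<or> v \<in> steep_normals (- b) G" if far: "v \<in> far_normals (\<kappa> * R)" for v
  proof -
    obtain x where x: "v \<in> sphere 0 1" "x \<in> K" "v \<bullet> x = h v" "\<kappa> * R \<le> norm x"
      using far by (auto simp: far_normals_def)
    have "\<exists>b\<in>Basis. G \<le> \<bar>x \<bullet> b\<bar>"
    proof (rule ccontr)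
      assume "\<not> ?thesis"
      then have "(\<Sum>b\<in>Basis. \<bar>x \<bullet> b\<bar>) < (\<Sum>b\<in>(Basis :: 'a set). G)"
        by (intro sum_strict_mono) auto
      then have "norm x < ?n * G" using norm_le_l1[of x] by simp
      then show False using x(4) by (simp add: G_def)
    qed
    then obtain b where b: "b \<in> Basis" "G \<le> \<bar>x \<bullet> b\<bar>" by blast
    then have "G \<le> b \<bullet> x \<or> G \<le> (- b) \<bullet> x" by (auto simp: inner_commute abs_if split: if_splits)
    then show ?thesis using x b(1) unfolding steep_normals_def by blast
  qed
  have "(\<integral>\<^sup>+v\<in>far_normals (\<kappa> * R). ennreal (h v powr (p - 1)) \<partial>spherical_measure)
      \<le> (\<integral>\<^sup>+v. (\<Sum>b\<in>Basis. ennreal (h v powr (p - 1)) * indicator (steep_normals b G) v +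
          ennreal (h v powr (p - 1)) * indicator (steep_normals (- b) G) v) \<partial>spherical_measure)"
  proof (rule nn_integral_mono)
    fix v :: 'a
    show "ennreal (h v powr (p - 1)) * indicator (far_normals (\<kappa> * R)) v
        \<le> (\<Sum>b\<in>Basis. ennreal (h v powr (p - 1)) * indicator (steep_normals b G) v +
          ennreal (h v powr (p - 1)) * indicator (steep_normals (- b) G) v)"
    proof (cases "v \<in> far_normals (\<kappa> * R)")
      case True
      then obtain b where b: "b \<in> Basis" "v \<in> steep_normals b G \<or> v \<in> steep_normals (- b) G"
        using cov by blast
      have "ennreal (h v powr (p - 1)) * indicator (far_normals (\<kappa> * R)) v
          \<le> ennreal (h v powr (p - 1)) * indicator (steep_normals b G) v +
            ennreal (h v powr (p - 1)) * indicator (steep_normals (- b) G) v"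
        using b(2) True by (auto simp: indicator_def)
      also have "\<dots> \<le> (\<Sum>b\<in>Basis. ennreal (h v powr (p - 1)) * indicator (steep_normals b G) v +
          ennreal (h v powr (p - 1)) * indicator (steep_normals (- b) G) v)"
        by (rule member_le_sum[OF b(1)]) auto
      finally show ?thesis .
    qed simp
  qed
  also have "\<dots> = (\<Sum>b\<in>Basis. I b + I (- b))"
    unfolding I_def
    by (subst nn_integral_sum) (auto intro!: borel_measurable_add Im sum.cong nn_integral_add)
  also have "\<dots> \<le> (\<Sum>b\<in>(Basis :: 'a set). ennreal (steep_const TYPE('a) p * G powr (p - 1)) + ennreal (steep_const TYPE('a) p * G powr (p - 1)))"
    by (intro sum_mono add_mono I) auto
  also have "\<dots> = ennreal (far_const TYPE('a) p \<kappa> * R powr (p - 1))"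
  proof -
    have "0 \<le> steep_const TYPE('a) p" using steep_const_pos[OF p_pos, where ?'a='a] by simp
    moreover have "far_const TYPE('a) p \<kappa> * R powr (p - 1) = ?n * (2 * (steep_const TYPE('a) p * G powr (p - 1)))"
      using False \<kappa> R by (simp add: far_const_def G_def powr_mult powr_divide)
    ultimately show ?thesis
      by (simp add: ennreal_mult ennreal_of_nat_eq_real_of_nat[symmetric] mult_2[symmetric] ennreal_plus[symmetric] del: ennreal_plus)
  qed
  finally show ?thesis .
qed

end

section \<open>Volume and widths\<close>

lemma convex_subsum_mem:
  fixes K :: "'b::real_vector set"
  assumes "convex K" "0 \<in> K" "finite I" "\<And>i. i \<in> I \<Longrightarrow> y i \<in> K" "\<And>i. i \<in> I \<Longrightarrow> 0 \<le> c i"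
    and "sum c I \<le> 1"
  shows "(\<Sum>i\<in>I. c i *\<^sub>R y i) \<in> K"
proof (cases "sum c I = 0")
  case True
  then have "c i = 0" if "i \<in> I" for i
    using assms that by (simp add: sum_nonneg_eq_0_iff)
  then show ?thesis using assms by (simp add: sum.neutral)
next
  case False
  let ?s = "sum c I"
  have s: "0 < ?s" using False assms(5) by (simp add: sum_nonneg order.not_eq_order_implies_strict)
  have "(\<Sum>i\<in>I. (c i / ?s) *\<^sub>R y i) \<in> K"
    using s assms by (intro convex_sum) (auto simp: sum_divide_distrib[symmetric])
  then have "(1 - ?s) *\<^sub>R 0 + ?s *\<^sub>R (\<Sum>i\<in>I. (c i / ?s) *\<^sub>R y i) \<in> K"
    using assms s by (intro convexD) auto
  then show ?thesis using s by (simp add: scaleR_sum_right)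
qed

text \<open>Rows in \<open>K\<close> of maximal determinant: replacing a row by another point of \<open>K\<close> multiplies the
  determinant by the corresponding coordinate of that point, by Cramer's rule.\<close>

lemma Auerbach_basis:
  fixes K :: "(real ^ 'n) set"
  assumes K: "compact K" "0 \<in> interior K"
  obtains y :: "'n \<Rightarrow> real ^ 'n"
  where "\<And>i. y i \<in> K" "\<And>z. z \<in> K \<Longrightarrow> \<exists>c. (\<forall>i. \<bar>c i\<bar> \<le> 1) \<and> z = (\<Sum>i\<in>UNIV. c i *\<^sub>R y i)"
proof -
  define M where "M = {A :: real^'n^'n. \<forall>i. A $ i \<in> K}"
  obtain B where B: "\<And>x. x \<in> K \<Longrightarrow> norm x \<le> B" using compact_imp_bounded[OF K(1)] by (auto simp: bounded_iff)
  have "closed M"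
  proof -
    have "M = (\<Inter>i. (\<lambda>A. A $ i) -` K)" by (auto simp: M_def)
    moreover have "closed ((\<lambda>A :: real^'n^'n. A $ i) -` K)" for i
      by (intro continuous_closed_vimage compact_imp_closed K) (auto intro: continuous_intros)
    ultimately show ?thesis by auto
  qed
  moreover have "bounded M"
    unfolding bounded_iff
  proof (intro exI[of _ "\<Sum>i\<in>(UNIV :: 'n set). B"] ballI)
    fix A assume "A \<in> M"
    have "norm A \<le> (\<Sum>i\<in>UNIV. norm (A $ i))" unfolding norm_vec_def by (rule L2_set_le_sum) simp
    also have "\<dots> \<le> (\<Sum>i\<in>(UNIV :: 'n set). B)" using \<open>A \<in> M\<close> by (intro sum_mono B) (auto simp: M_def)
    finally show "norm A \<le> (\<Sum>i\<in>(UNIV :: 'n set). B)" .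
  qed
  ultimately have "compact M" by (simp add: compact_eq_bounded_closed)
  moreover obtain r where r: "0 < r" "cball 0 r \<subseteq> K" using K(2) by (auto simp: mem_interior_cball)
  define D :: "real^'n^'n" where "D = (\<chi> i j. if i = j then r else 0)"
  have "D $ i = axis i r" for i by (simp add: D_def axis_def vec_eq_iff)
  then have DM: "D \<in> M" using r by (auto simp: M_def norm_eq_sqrt_inner inner_axis_axis intro!: subsetD[OF r(2)])
  have "det D = r ^ CARD('n)" unfolding D_def by (subst det_diagonal) auto
  then have detD: "det D \<noteq> 0" using r by simp
  have "continuous_on M (\<lambda>A. \<bar>det A\<bar>)" unfolding det_def by (intro continuous_intros)
  ultimately obtain A where A: "A \<in> M" "\<And>A'. A' \<in> M \<Longrightarrow> \<bar>det A'\<bar> \<le> \<bar>det A\<bar>"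
    using continuous_attains_sup[of M "\<lambda>A. \<bar>det A\<bar>"] DM by blast
  have detA: "det A \<noteq> 0" using A(2)[OF DM] detD by auto
  show ?thesis
  proof (rule that[of "\<lambda>i. A $ i"])
    show "A $ i \<in> K" for i using A(1) by (simp add: M_def)
    fix z assume z: "z \<in> K"
    define x where "x = (\<chi> k. det (\<chi> i j. if j = k then z $ i else transpose A $ i $ j) / det (transpose A))"
    have "transpose A *v x = z"
      using detA by (subst cramer) (auto simp: det_transpose x_def)
    then have zx: "z = (\<Sum>i\<in>UNIV. x $ i *s row i A)"
      by (simp add: matrix_mult_sum)
    have "\<bar>x $ k\<bar> \<le> 1" for k
    proof -
      let ?A = "(\<chi> i. if i = k then z else row i A) :: real^'n^'n"
      have "?A \<in> M" using A(1) z by (auto simp: M_def row_def)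
      then have "\<bar>det ?A\<bar> \<le> \<bar>det A\<bar>" by (rule A(2))
      also have "det ?A = x $ k * det A"
        unfolding zx by (rule cramer_lemma_transpose)
      finally show ?thesis using detA by (simp add: abs_mult)
    qed
    moreover have "z = (\<Sum>i\<in>UNIV. x $ i *\<^sub>R A $ i)"
      using zx by (simp add: row_def scalar_mult_eq_scaleR)
    ultimately show "\<exists>c. (\<forall>i. \<bar>c i\<bar> \<le> 1) \<and> z = (\<Sum>i\<in>UNIV. c i *\<^sub>R A $ i)" by blast
  qed
qed

text \<open>The parallelepiped spanned by an Auerbach basis contains \<open>K\<close> and hence, being symmetric, a
  ball as large as the widths of \<open>K\<close> allow; a copy of it shrunk by the factor \<open>2n\<close> lies in \<open>K\<close>.\<close>

lemma volume_ge_of_widths: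
  fixes K :: "(real ^ 'n) set"
  assumes K: "compact K" "convex K" "0 \<in> interior K" and W: "0 < W"
    and width: "\<And>w. norm w = 1 \<Longrightarrow> \<exists>x\<in>K. W \<le> \<bar>x \<bullet> w\<bar>"
  shows "(W / (2 * real CARD('n))) ^ CARD('n) * measure lborel (ball (0 :: real^'n) 1) \<le> measure lborel K"
proof -
  let ?n = "real CARD('n)"
  have zero: "0 \<in> K" using K(3) interior_subset by blast
  obtain y :: "'n \<Rightarrow> real ^ 'n" where y: "\<And>i. y i \<in> K" "\<And>z. z \<in> K \<Longrightarrow> \<exists>c. (\<forall>i. \<bar>c i\<bar> \<le> 1) \<and> z = (\<Sum>i\<in>UNIV. c i *\<^sub>R y i)"
    using Auerbach_basis[OF K(1,3)] by blast
  define f where "f x = (\<Sum>i\<in>UNIV. (x $ i) *\<^sub>R y i)" for x :: "real ^ 'n"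
  define Q where "Q = {x :: real^'n. \<forall>i. \<bar>x $ i\<bar> \<le> 1}"
  have lin: "linear f"
    unfolding f_def by (rule linearI) (simp_all add: scaleR_add_left sum.distrib scaleR_sum_right)
  have Qbox: "Q = cbox (- 1) 1"
    by (auto simp: Q_def cbox_def inner_axis Basis_vec_def abs_le_iff minus_le_iff)
  have P: "compact (f ` Q)" "convex (f ` Q)"
    unfolding Qbox
    by (intro compact_continuous_image linear_continuous_on compact_cbox linear_conv_bounded_linear[THEN iffD1] lin)
       (intro convex_linear_image convex_box lin)
  have KP: "K \<subseteq> f ` Q"
  proof
    fix z assume "z \<in> K"
    then obtain c where c: "\<And>i. \<bar>c i\<bar> \<le> 1" "z = (\<Sum>i\<in>UNIV. c i *\<^sub>R y i)" using y(2) by blast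
    then have "(\<chi> i. c i) \<in> Q" "z = f (\<chi> i. c i)" by (auto simp: Q_def f_def)
    then show "z \<in> f ` Q" by blast
  qed
  have sym: "- x \<in> f ` Q" if xP: "x \<in> f ` Q" for x
  proof -
    obtain z where "z \<in> Q" "x = f z" using xP by blast
    then have "- z \<in> Q" "- x = f (- z)" by (auto simp: Q_def linear_neg[OF lin])
    then show ?thesis by blast
  qed
  have ball: "ball 0 W \<subseteq> f ` Q"
  proof (rule ccontr)
    assume "\<not> ?thesis"
    then obtain z where z: "norm z < W" "z \<notin> f ` Q" by (auto simp: subset_iff)
    obtain a b where ab: "a \<bullet> z < b" "\<And>x. x \<in> f ` Q \<Longrightarrow> b < a \<bullet> x"
      using separating_hyperplane_closed_point[OF P(2) compact_imp_closed[OF P(1)] z(2)] by blast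
    have a: "a \<noteq> 0" using ab(1) ab(2)[of 0] zero KP by force
    obtain x where x: "x \<in> K" "W \<le> \<bar>x \<bullet> (a /\<^sub>R norm a)\<bar>" using width[of "a /\<^sub>R norm a"] a by auto
    have "b < a \<bullet> x" "b < - (a \<bullet> x)" using ab(2)[of x] ab(2)[OF sym[of x]] KP x(1) by auto
    then have "\<bar>a \<bullet> x\<bar> < - (a \<bullet> z)" using ab(1) by linarith
    also have "- (a \<bullet> z) \<le> norm a * norm z" using norm_cauchy_schwarz[of "- a" z] by simp
    also have "\<dots> \<le> norm a * W" using z by (intro mult_left_mono) auto
    finally have "\<bar>a \<bullet> x\<bar> / norm a < W" using a by (simp add: pos_divide_less_eq mult.commute)
    moreover have "\<bar>x \<bullet> (a /\<^sub>R norm a)\<bar> = \<bar>a \<bullet> x\<bar> / norm a"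
      by (simp add: inner_commute divide_inverse_commute abs_mult)
    ultimately show False using x(2) by simp
  qed
  \<comment> \<open>The points of the parallelepiped with coordinates in \<open>[0, 1/n]\<close> are sums of at most one unit of
    mass on points of \<open>K\<close> and the origin; the map \<open>x \<mapsto> 2n x - f 1\<close> blows them up to coordinates in
    \<open>[-1, 1]\<close>.\<close>
  have shrunk: "x \<in> K" if x: "- f 1 + (2 * ?n) *\<^sub>R x \<in> f ` Q" for x
  proof -
    obtain z where z: "z \<in> Q" "- f 1 + (2 * ?n) *\<^sub>R x = f z" using x by blast
    then have "(2 * ?n) *\<^sub>R x = f (z + 1)" by (simp add: linear_add[OF lin] algebra_simps)
    then have "(1 / (2 * ?n)) *\<^sub>R ((2 * ?n) *\<^sub>R x) = (1 / (2 * ?n)) *\<^sub>R f (z + 1)" by (simp only:)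
    then have "x = (1 / (2 * ?n)) *\<^sub>R f (z + 1)" by simp
    then have "x = (\<Sum>i\<in>UNIV. ((z $ i + 1) / (2 * ?n)) *\<^sub>R y i)"
      by (simp add: f_def scaleR_sum_right)
    also have "\<dots> \<in> K"
    proof (rule convex_subsum_mem[OF K(2) zero])
      show "0 \<le> (z $ i + 1) / (2 * ?n)" for i
      proof -
        have "- 1 \<le> z $ i" using z(1) by (simp add: Q_def abs_le_iff minus_le_iff)
        then show ?thesis by simp
      qed
      have "(\<Sum>i\<in>UNIV. (z $ i + 1) / (2 * ?n)) \<le> (\<Sum>i\<in>(UNIV :: 'n set). 1 / ?n)"
        using z(1) by (intro sum_mono) (auto simp: Q_def abs_le_iff field_simps)
      also have "\<dots> = 1" by simp
      finally show "(\<Sum>i\<in>UNIV. (z $ i + 1) / (2 * ?n)) \<le> 1" .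
    qed (use y in auto)
    finally show ?thesis .
  qed
  have Kf: "emeasure lborel K < \<infinity>" using compact_imp_bounded[OF K(1)] by (rule emeasure_bounded_finite)
  have Km: "K \<in> sets borel" using compact_imp_closed[OF K(1)] by auto
  have "emeasure lborel (ball (0 :: real^'n) W) \<le> emeasure lborel (f ` Q)"
    using ball compact_imp_closed[OF P(1)] by (intro emeasure_mono) auto
  also have "\<dots> = ennreal (\<bar>2 * ?n\<bar> ^ DIM(real^'n)) * emeasure lborel {x. - f 1 + (2 * ?n) *\<^sub>R x \<in> f ` Q}"
    using compact_imp_closed[OF P(1)] by (intro emeasure_lborel_affine_vimage) auto
  also have "\<dots> \<le> ennreal ((2 * ?n) ^ CARD('n)) * emeasure lborel K"
    using shrunk Km by (intro mult_mono emeasure_mono) auto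
  finally have "emeasure lborel (ball (0 :: real^'n) W) \<le> ennreal ((2 * ?n) ^ CARD('n)) * emeasure lborel K" .
  then have "ennreal (measure lborel (ball (0 :: real^'n) W)) \<le> ennreal ((2 * ?n) ^ CARD('n) * measure lborel K)"
    using Kf emeasure_lborel_ball_finite[of "0 :: real^'n" W]
    by (simp add: emeasure_eq_ennreal_measure ennreal_mult)
  then have "measure lborel (ball (0 :: real^'n) W) \<le> (2 * ?n) ^ CARD('n) * measure lborel K"
    by (subst (asm) ennreal_le_iff) auto
  moreover have "measure lborel (ball (0 :: real^'n) W) = W ^ CARD('n) * measure lborel (ball (0 :: real^'n) 1)"
    using W by (simp add: content_ball)
  ultimately show ?thesis
    by (simp add: power_divide field_simps)
qed

section \<open>The a priori bounds\<close>

lemma radial_weight_ge_volume: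
  fixes A :: "'a::euclidean_space set" and q R :: real
  assumes A: "A \<in> sets borel" and R: "\<And>x. x \<in> A \<Longrightarrow> norm x \<le> R" and q: "q \<le> DIM('a)"
  shows "ennreal (R powr (q - DIM('a))) * emeasure lborel A \<le> emeasure (radial_weight q) A"
proof -
  have "ennreal (R powr (q - DIM('a))) * emeasure lborel A
      = (\<integral>\<^sup>+x. ennreal (R powr (q - DIM('a))) * indicator A x \<partial>lborel)"
    using A by (simp add: nn_integral_cmult_indicator)
  also have "\<dots> \<le> (\<integral>\<^sup>+x. ennreal (norm x powr (q - DIM('a))) * indicator A x \<partial>lborel)"
  proof (rule nn_integral_mono_AE)
    have "AE x::'a in lborel. x \<noteq> 0" by (rule AE_lborel_singleton)
    then show "AE x in lborel. ennreal (R powr (q - DIM('a))) * indicator A x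
        \<le> ennreal (norm x powr (q - DIM('a))) * indicator A x"
    proof eventually_elim
      fix x :: 'a assume "x \<noteq> 0"
      then show "ennreal (R powr (q - DIM('a))) * indicator A x
          \<le> ennreal (norm x powr (q - DIM('a))) * indicator A x"
        using R q by (auto simp: indicator_def intro!: ennreal_leI powr_mono2')
    qed
  qed
  also have "\<dots> = emeasure (radial_weight q) A" by (rule emeasure_radial_weight[OF A, symmetric])
  finally show ?thesis .
qed

text \<open>The following constants depend on the dimension and on \<open>p\<close>, \<open>q\<close>, \<open>l\<close> alone: the dual volume of \<open>K\<close>
  is at least \<open>mass_const \<cdot> R\<^sup>p\<close>, at least a quarter of the mass of \<open>K\<close> lies outside the ball of radius
  \<open>near_const \<cdot> R\<close>, and no slab \<open>|x \<bullet> w| < width_const \<cdot> R\<close> with a unit vector \<open>w\<close> contains \<open>K\<close>.\<close>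

definition mass_const :: "'a::euclidean_space itself \<Rightarrow> real \<Rightarrow> real \<Rightarrow> real" where
  "mass_const _ p l = cap_area TYPE('a) / (l * 2 powr p)"

definition near_const :: "'a::euclidean_space itself \<Rightarrow> real \<Rightarrow> real \<Rightarrow> real \<Rightarrow> real" where
  "near_const _ p q l = min 1
     ((mass_const TYPE('a) p l / (2 * 2 powr q * 2 powr q * l * sphere_area TYPE('a))) powr (1 / min p 1))"

definition width_const :: "'a::euclidean_space itself \<Rightarrow> real \<Rightarrow> real \<Rightarrow> real \<Rightarrow> real" where
  "width_const _ p q l = min (near_const TYPE('a) p q l / 6)
     (mass_const TYPE('a) p l / (12 * 2 ^ DIM('a) * 2 powr q * 2 powr q * l *
       far_const TYPE('a) p (near_const TYPE('a) p q l / 4)))"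

lemma mass_const_pos: "0 < l \<Longrightarrow> 0 < mass_const TYPE('a::euclidean_space) p l"
  using cap_area_pos[where ?'a='a] by (simp add: mass_const_def)

lemma near_const_pos:
  assumes "0 < l" shows "0 < near_const TYPE('a::euclidean_space) p q l"
  using assms mass_const_pos[OF assms, of p, where ?'a='a] sphere_area_pos[where ?'a='a]
  by (simp add: near_const_def)

lemma width_const_pos: "0 < p \<Longrightarrow> 0 < l \<Longrightarrow> 0 < width_const TYPE('a::euclidean_space) p q l"
  using near_const_pos[of l p q, where ?'a='a] mass_const_pos[of l p, where ?'a='a]
    far_const_pos[of p "near_const TYPE('a) p q l / 4", where ?'a='a]
  by (simp add: width_const_def)

context pinched_curvature
begin

text \<open>A quarter of the mass \<open>U\<close> lies far out, because \<open>near_const\<close> makes the error term in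
  \<open>radial_weight_le_far_part\<close> at most \<open>U/2\<close>. If \<open>|x \<bullet> w| \<le> W\<close> on \<open>K\<close> for a small \<open>W\<close>, the far mass is at
  most a constant times \<open>W R\<^sup>p\<^sup>-\<^sup>1\<close>, while \<open>U\<close> is at least a constant times \<open>R\<^sup>p\<close>.\<close>

lemma width_ge:
  assumes R: "\<And>x. x \<in> K \<Longrightarrow> norm x \<le> R" "0 < R" and a: "a \<in> K" "norm a = R" and w: "norm w = 1"
  shows "\<exists>x\<in>K. width_const TYPE('a) p q l * R \<le> \<bar>x \<bullet> w\<bar>"
proof -
  let ?\<mu> = "radial_weight q :: 'a measure"
  let ?\<delta> = "near_const TYPE('a) p q l"
  let ?c = "mass_const TYPE('a) p l"
  let ?A = "sphere_area TYPE('a)"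
  let ?F = "far_const TYPE('a) p (?\<delta> / 4)"
  have pos: "0 < ?\<delta>" "0 < ?c" "0 < ?A" "0 < ?F"
    using near_const_pos[OF l_pos, of p q, where ?'a='a] mass_const_pos[OF l_pos, of p, where ?'a='a]
      sphere_area_pos[where ?'a='a] far_const_pos[OF p_pos, of "?\<delta> / 4", where ?'a='a] by simp_all
  have \<delta>1: "?\<delta> \<le> 1" by (simp add: near_const_def)
  have "continuous_on K (\<lambda>x. \<bar>x \<bullet> w\<bar>)" by (intro continuous_intros)
  then obtain x0 where x0: "x0 \<in> K" "\<And>x. x \<in> K \<Longrightarrow> \<bar>x \<bullet> w\<bar> \<le> \<bar>x0 \<bullet> w\<bar>"
    using continuous_attains_sup[OF compact_K nonempty] by blast
  define W where "W = \<bar>x0 \<bullet> w\<bar>"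
  obtain r where r: "0 < r" "cball 0 r \<subseteq> K" by (rule inball)
  have W: "0 < W"
  proof -
    have "r *\<^sub>R w \<in> K" using w r by (intro subsetD[OF r(2)]) simp
    from x0(2)[OF this] show ?thesis using w r by (simp add: W_def dot_square_norm)
  qed
  have "width_const TYPE('a) p q l * R \<le> W"
  proof (cases "6 * W \<le> ?\<delta> * R")
    case False
    have "width_const TYPE('a) p q l * R \<le> ?\<delta> / 6 * R"
      using R by (intro mult_right_mono) (auto simp: width_const_def)
    then show ?thesis using False by simp
  next
    case True
    define U Fm where "U = measure ?\<mu> K" and "Fm = measure ?\<mu> (K - cball 0 (?\<delta> * R))"
    have UE: "emeasure ?\<mu> K = ennreal U"
      using radial_weight_finite by (simp add: U_def emeasure_eq_ennreal_measure)
    have "emeasure ?\<mu> (K - cball 0 (?\<delta> * R)) \<le> emeasure ?\<mu> K"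
      using closed_K by (intro emeasure_mono) auto
    then have "emeasure ?\<mu> (K - cball 0 (?\<delta> * R)) < \<infinity>"
      using radial_weight_finite by (rule le_less_trans)
    then have FE: "emeasure ?\<mu> (K - cball 0 (?\<delta> * R)) = ennreal Fm"
      by (simp add: Fm_def emeasure_eq_ennreal_measure)
    have nn: "0 \<le> U" "0 \<le> Fm" by (simp_all add: U_def Fm_def)
    have "ennreal (?c * R powr p) \<le> ennreal (2 powr q) * ennreal U"
      using order.trans[OF dual_volume_ge[OF a(1)] dual_volume_le_radial_weight[OF q_ge]]
      by (simp add: a(2) UE mass_const_def)
    then have mass: "?c * R powr p \<le> 2 powr q * U" using nn by (simp add: ennreal_mult[symmetric])
    let ?E = "2 powr q * l * ?A * (?\<delta> powr min p 1 * R powr p)"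
    have "ennreal U \<le> 2 * ennreal Fm + ennreal ?E"
      using radial_weight_le_far_part[OF R pos(1) \<delta>1] by (simp add: UE FE)
    also have "\<dots> = ennreal (2 * Fm + ?E)"
      using nn pos l_pos by (simp add: ennreal_plus[symmetric] ennreal_mult[symmetric] del: ennreal_plus flip: ennreal_numeral)
    finally have near: "U \<le> 2 * Fm + ?E"
      using nn pos l_pos by (subst (asm) ennreal_le_iff) auto
    have small: "2 * 2 powr q * ?E \<le> ?c * R powr p"
    proof -
      let ?x = "?c / (2 * 2 powr q * 2 powr q * l * ?A)"
      have x: "0 < ?x" using pos l_pos by simp
      have "?\<delta> powr min p 1 \<le> (?x powr (1 / min p 1)) powr min p 1"
        using p_pos pos(1) by (intro powr_mono2) (auto simp: near_const_def)
      also have "\<dots> = ?x"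
      proof -
        have "(y powr (1 / g)) powr g = y" if "0 < y" "0 < g" for y g :: real
          using that by (simp add: powr_powr)
        then show ?thesis using x p_pos by simp
      qed
      finally have "?\<delta> powr min p 1 * (2 * 2 powr q * 2 powr q * l * ?A) \<le> ?c"
        using pos l_pos by (simp add: pos_le_divide_eq)
      from mult_right_mono[OF this, of "R powr p"] show ?thesis by (simp add: mult_ac)
    qed
    have "2 powr q * (2 * ?E) = 2 * 2 powr q * ?E" by (simp only: mult_ac)
    then have "2 powr q * (2 * ?E) \<le> 2 powr q * U" using small mass by linarith
    then have "2 * ?E \<le> U" by (rule mult_left_le_imp_le) simp
    then have UF: "U \<le> 4 * Fm" using near by linarith
    have "ennreal Fm \<le> ennreal (3 * 2 ^ DIM('a) * 2 powr q * l * W) *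
        (\<integral>\<^sup>+v\<in>far_normals (?\<delta> / 4 * R). ennreal (h v powr (p - 1)) \<partial>spherical_measure)"
      using far_part_le[of w W "?\<delta> * R"] w x0(2) W True by (simp add: FE W_def)
    also have "\<dots> \<le> ennreal (3 * 2 ^ DIM('a) * 2 powr q * l * W) * ennreal (?F * R powr (p - 1))"
      using pos by (intro mult_left_mono far_integral_le R) auto
    also have "\<dots> = ennreal (3 * 2 ^ DIM('a) * 2 powr q * l * W * (?F * R powr (p - 1)))"
      using pos l_pos W by (intro ennreal_mult[symmetric]) auto
    finally have "Fm \<le> 3 * 2 ^ DIM('a) * 2 powr q * l * W * (?F * R powr (p - 1))"
      using pos l_pos W by (subst (asm) ennreal_le_iff) auto
    then have "2 powr q * U \<le> 2 powr q * (4 * (3 * 2 ^ DIM('a) * 2 powr q * l * W * (?F * R powr (p - 1))))"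
      using UF by (intro mult_left_mono) auto
    then have "?c * R powr p \<le> 2 powr q * (4 * (3 * 2 ^ DIM('a) * 2 powr q * l * W * (?F * R powr (p - 1))))"
      by (rule order.trans[OF mass])
    also have "\<dots> = (12 * 2 ^ DIM('a) * 2 powr q * 2 powr q * l * ?F) * W * R powr (p - 1)"
      by (simp add: mult_ac)
    finally have "?c * R powr p \<le> (12 * 2 ^ DIM('a) * 2 powr q * 2 powr q * l * ?F) * W * R powr (p - 1)" .
    moreover have "R powr p = R * R powr (p - 1)" using R by (simp add: powr_mult_base)
    ultimately have "(?c * R) * R powr (p - 1) \<le> ((12 * 2 ^ DIM('a) * 2 powr q * 2 powr q * l * ?F) * W) * R powr (p - 1)"
      by (simp only: mult.assoc)
    then have "?c * R \<le> (12 * 2 ^ DIM('a) * 2 powr q * 2 powr q * l * ?F) * W"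
      by (rule mult_right_le_imp_le) (use R in simp)
    then have "?c / (12 * 2 ^ DIM('a) * 2 powr q * 2 powr q * l * ?F) * R \<le> W"
      using pos l_pos by (simp add: field_simps)
    moreover have "width_const TYPE('a) p q l * R \<le> ?c / (12 * 2 ^ DIM('a) * 2 powr q * 2 powr q * l * ?F) * R"
      using R by (intro mult_right_mono) (auto simp: width_const_def)
    ultimately show ?thesis by linarith
  qed
  then show ?thesis using x0(1) by (auto simp: W_def)
qed

end

lemma powr_root_le:
  fixes x y d :: real
  assumes "0 < x" "0 < y" "0 < d" "x powr d \<le> y" shows "x \<le> y powr (1 / d)"
proof -
  have "(x powr d) powr (1 / d) \<le> y powr (1 / d)" using assms by (intro powr_mono2) auto
  then show ?thesis using assms by (simp add: powr_powr)
qed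

lemma powr_root_ge:
  fixes x y d :: real
  assumes "0 < x" "0 < y" "0 < d" "y \<le> x powr d" shows "y powr (1 / d) \<le> x"
proof -
  have "y powr (1 / d) \<le> (x powr d) powr (1 / d)" using assms by (intro powr_mono2) auto
  then show ?thesis using assms by (simp add: powr_powr)
qed

theorem theorem1p2:
  fixes p q l :: real
  assumes "CARD('n::finite) \<ge> 2"
    and "1 < q" and "q \<le> real CARD('n)"
    and "0 < p" and "p < q"
    and "1 < l"
  shows "\<exists>C>0. \<forall>f :: real ^ 'n \<Rightarrow> real. smooth_on_sphere f \<longrightarrow>
    (\<forall>K\<in>convex_bodies_o.
       Lp_dual_curvature p q K = density spherical_measure (\<lambda>v. ennreal (f v)) \<longrightarrow>
       (\<forall>\<eta>\<in>sets (restrict_space borel (sphere 0 1)).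
          ennreal (1 / l) * emeasure spherical_measure \<eta>
            \<le> emeasure (Lp_dual_curvature p q K) \<eta> \<and>
          emeasure (Lp_dual_curvature p q K) \<eta>
            \<le> ennreal l * emeasure spherical_measure \<eta>) \<longrightarrow>
       (SUP x\<in>sphere 0 1. support_fun K x) \<le> C \<and> measure lborel K \<ge> 1 / C)"
proof -
  let ?n = "real CARD('n)"
  define w where "w = width_const TYPE(real^'n) p q l"
  define m where "m = mass_const TYPE(real^'n) p l"
  define S where "S = sphere_area TYPE(real^'n)"
  define c where "c = (w / (2 * ?n)) ^ CARD('n) * measure lborel (ball (0 :: real^'n) 1)"
  define R1 where "R1 = (l * S / c) powr (1 / (q - p))"
  define R0 where "R0 = (m / S) powr (1 / (q - p))"
  have l: "0 < l" and qp: "0 < q - p" using assms by simp_all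
  have pos: "0 < w" "0 < m" "0 < S"
    using width_const_pos[OF assms(4) l, where ?'a="real^'n"] mass_const_pos[OF l, where ?'a="real^'n"]
      sphere_area_pos[where ?'a="real^'n"] by (simp_all add: w_def m_def S_def)
  have c: "0 < c" using pos content_ball_pos[of 1 "0 :: real^'n"] by (simp add: c_def)
  have R0: "0 < R0" and R1: "0 < R1" using pos l c by (simp_all add: R0_def R1_def)
  define C where "C = max R1 (1 / (c * R0 ^ CARD('n)))"
  have C: "0 < C" using R1 by (simp add: C_def)
  have main: "(SUP x\<in>sphere 0 1. support_fun K x) \<le> C \<and> measure lborel K \<ge> 1 / C"
    if K: "K \<in> convex_bodies_o" and b: "\<forall>\<eta>\<in>sets sphere_borel.
      ennreal (1 / l) * emeasure spherical_measure \<eta> \<le> emeasure (Lp_dual_curvature p q K) \<eta> \<and>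
      emeasure (Lp_dual_curvature p q K) \<eta> \<le> ennreal l * emeasure spherical_measure \<eta>"
    for K :: "(real ^ 'n) set"
  proof -
    interpret pinched_curvature K p q l
      by unfold_locales (use K b assms in auto)
    obtain a where a: "a \<in> K" "\<And>x. x \<in> K \<Longrightarrow> norm x \<le> norm a"
      using continuous_attains_sup[OF compact_K nonempty continuous_on_norm_id] by blast
    define R where "R = norm a"
    obtain r where r: "0 < r" "cball 0 r \<subseteq> K" by (rule inball)
    have R: "0 < R"
    proof -
      have "r *\<^sub>R axis undefined 1 \<in> K" using r by (intro subsetD[OF r(2)]) simp
      from a(2)[OF this] have "r \<le> R" using r by (simp add: R_def)
      with r(1) show ?thesis by linarith
    qed
    have "\<And>v. norm v = 1 \<Longrightarrow> \<exists>x\<in>K. w * R \<le> \<bar>x \<bullet> v\<bar>"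
      unfolding w_def by (intro width_ge[where a=a]) (use a R in \<open>auto simp: R_def\<close>)
    from volume_ge_of_widths[OF compact_K convex_K zero_interior _ this] pos R
    have vol: "c * R ^ CARD('n) \<le> measure lborel K"
      by (simp add: c_def power_mult_distrib power_divide mult_ac)
    have Kf: "emeasure lborel K < \<infinity>" using bounded_K by (rule emeasure_bounded_finite)
    have "ennreal (R powr (q - ?n)) * emeasure lborel K \<le> ennreal (l * S * R powr p)"
      using radial_weight_ge_volume[of K R q] radial_weight_le_dual_volume[OF q_ge]
        dual_volume_le_support[of R] a closed_K assms(3) by (auto simp: R_def S_def intro: order.trans)
    then have "ennreal (R powr (q - ?n) * measure lborel K) \<le> ennreal (l * S * R powr p)"
      using Kf by (simp add: emeasure_eq_ennreal_measure ennreal_mult)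
    then have "R powr (q - ?n) * measure lborel K \<le> l * S * R powr p"
      using l pos by (subst (asm) ennreal_le_iff) auto
    then have "R powr (q - ?n) * (c * R ^ CARD('n)) \<le> l * S * R powr p"
      using mult_left_mono[OF vol, of "R powr (q - ?n)"] by simp
    moreover have "R powr (q - ?n) * R ^ CARD('n) = R powr (q - p) * R powr p"
      using R by (simp add: powr_realpow[symmetric] powr_add[symmetric])
    ultimately have "(c * R powr (q - p)) * R powr p \<le> (l * S) * R powr p" by (simp add: mult_ac)
    then have "R powr (q - p) \<le> l * S / c" using R c by (simp add: field_simps)
    then have RR1: "R \<le> R1"
      unfolding R1_def using R qp l pos c by (intro powr_root_le) auto
    have "ennreal (m * R powr p) \<le> ennreal (R powr q * S)"
      using order.trans[OF dual_volume_ge[OF a(1)] dual_volume_le[of q R]] a(2) assms pos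
      by (simp add: R_def m_def mass_const_def S_def emeasure_sphere ennreal_mult)
    then have "m * R powr p \<le> R powr q * S" using pos by (subst (asm) ennreal_le_iff) auto
    also have "R powr q = R powr (q - p) * R powr p" using R by (simp add: powr_add[symmetric])
    finally have "m * R powr p \<le> (R powr (q - p) * S) * R powr p" by (simp add: mult_ac)
    then have "m / S \<le> R powr (q - p)" using R pos by (simp add: field_simps)
    then have RR0: "R0 \<le> R" unfolding R0_def using R qp pos by (intro powr_root_ge) auto
    have "(SUP x\<in>sphere 0 1. support_fun K x) \<le> R"
    proof (rule cSUP_least)
      show "sphere (0 :: real^'n) 1 \<noteq> {}" by simp
      fix x :: "real^'n" assume "x \<in> sphere 0 1"
      then show "support_fun K x \<le> R"
        using support_fun_norm_le[OF compact_K nonempty a(2), of x] by (simp add: R_def)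
    qed
    moreover have "1 / C \<le> c * R0 ^ CARD('n)"
    proof -
      have "0 < c * R0 ^ CARD('n)" "1 / (c * R0 ^ CARD('n)) \<le> C" using c R0 by (simp_all add: C_def)
      then show ?thesis using C by (simp add: pos_divide_le_eq mult.commute)
    qed
    moreover have "c * R0 ^ CARD('n) \<le> c * R ^ CARD('n)"
      using c R0 RR0 by (intro mult_left_mono power_mono) auto
    ultimately show ?thesis using RR1 vol by (auto simp: C_def)
  qed
  show ?thesis using C main by blast
qed

end
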